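(* Let $A=((a_n,r_n))_{n\ge 0}\in\mathcal N$ be a redundancy-free abstract Swiss cheese. Let $I\subseteq\mathbb N$ be non-empty, let $(K_n)_{n\in I}$ be a collection of compact plane sets and let $(M_n)_{n\in I}$ be a collection of positive real numbers. For each $n\in I$ let $U_n:=\{z\in\mathbb C:\operatorname{dist}(z,K_n)<M_n\}$. Suppose that $U_k\subseteq B(a_0,r_0)$ and $\rho_{U_k}(A)<M_k/2$ for all $k\in I$, and that $U_k\cap U_\ell=\emptyset$ for all distinct $k,\ell\in I$. Let $\mathcal C:=((K_n,U_n))_{n\in I}$ and suppose that $E(A)\subseteq F(\mathcal C)$. Then there exists $B=((b_n,s_n))\in\mathcal L_A^*(\mathcal C)$ such that $X_B\setminus V(\mathcal C)=X_A\setminus V(\mathcal C)$ and $B$ is classical.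
   Context: Notation: $\mathbb R^+=[0,\infty)$, $\mathbb N=\{1,2,\dots\}$, $\mathbb N_0=\{0,1,2,\dots\}$. For $a\in\mathbb C$, $r>0$, $B(a,r)$ and $\bar B(a,r)$ are the open and closed disks of centre $a$ and radius $r$; $B(a,0)=\emptyset$ and $\bar B(a,0)=\{a\}$. A compact plane set is a non-empty compact subset of $\mathbb C$. $\operatorname{dist}(z,E)=\inf\{|z-x|:x\in E\}$. Abstract Swiss cheese space is $\mathcal F=(\mathbb C\times\mathbb R^+)^{\mathbb N_0}$ with the product topology; its elements $A=((a_n,r_n))_{n\ge0}$ are abstract Swiss cheeses. Put $S_A=\{n\in\mathbb N:r_n>0\}$, $X_A=\bar B(a_0,r_0)\setminus\bigcup_{n=1}^\infty B(a_n,r_n)$, $\rho(A)=\sum_{n=1}^\infty r_n$, $\mu(A)=\sup_{n\in\mathbb N}|a_n|$, $\delta_1(A)=r_0-\sum_{n=1}^\infty r_n$. For $E\subseteq\mathbb C$, $H_A(E)=\{n\in S_A:\bar B(a_n,r_n)\cap E\ne\emptyset\}$ and $\rho_E(A)=\sum_{n\in H_A(E)}r_n$. $A$ is classical if $\sum_{n\ge1}r_n<\infty$, $r_0>0$, and for all $k\in S_A$: $\bar B(a_k,r_k)\subseteq B(a_0,r_0)$, and $\bar B(a_k,r_k)\cap\bar B(a_\ell,r_\ell)=\emptyset$ for all $\ell\in S_A$ with $\ell\ne k$. $A$ is redundancy-free if for all $k\in S_A$ we have $B(a_k,r_k)\cap\bar B(a_0,r_0)\neq\emptyset$ and $B(a_k,r_k)\not\subseteq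 B(a_\ell,r_\ell)$ for all $\ell\in S_A$ with $\ell\neq k$. $\mathcal N$ is the set of $A\in\mathcal F$ with $\rho(A)<\infty$ and $(r_n)_{n\ge1}$ non-increasing. (For redundancy-free $A\in\mathcal N$, both $\rho(A)$ and $\mu(A)$ are finite.) $\mathcal N(M,R)=\{B\in\mathcal N:\mu(B)\le M,\ \rho(B)\le R\}$. The error set of $A$ is $$E(A)=\bigcup_{m,n\in S_A,\,m\ne n}\big(\bar B(a_m,r_m)\cap\bar B(a_n,r_n)\big)\ \cup\ \bigcup_{n\in S_A}\big((\mathbb C\setminus B(a_0,r_0))\cap\bar B(a_n,r_n)\big).$$ A controlling collection of pairs is an indexed collection $\mathcal C=((K_n,U_n))_{n\in I}$ with $\emptyset\neq I\subseteq\mathbb N$, each $K_n$ a compact plane set, each $U_n$ open and $K_n\subseteq U_n$. Put $V(\mathcal C)=\bigcup_{n\in I}U_n$ and $F(\mathcal C)=\bigcup_{n\in I}K_n$. For redundancy-free $A\in\mathcal N$, $\mathcal L_A(\mathcal C)$ is the set of all $B=((b_n,s_n))\in\mathcal N(\mu(A),\rho(A))$ such that: (a) $\rho_{U_n}(B)\le\rho_{U_n}(A)$ for each $n\in I$; (b) $\bar B(b_0,s_0)=\bar B(a_0,r_0)$; (c) for all $k\in S_A$ with $\bar B(a_k,r_k)\cap V(\mathcal C)=\emptyset$ there exists $\ell\in S_B$ with $B(b_\ell,s_\ell)=B(a_k,r_k)$; (d) for each $n\in I$ and all $k\in S_A$ with $\bar B(a_k,r_k)\cap U_n\ne\emptyset$: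 either there exists $\ell\in S_B$ with $B(b_\ell,s_\ell)=B(a_k,r_k)$, or there exists $\ell\in H_B(K_n)$ with $B(a_k,r_k)\subseteq B(b_\ell,s_\ell)$. $\mathcal L_A^*(\mathcal C)$ is the set of those $B\in\mathcal L_A(\mathcal C)$ at which $\delta_1$ attains its maximum over $\mathcal L_A(\mathcal C)$. *)

theory Defs
  imports "HOL-Analysis.Analysis"
begin

section \<open>Abstract Swiss cheeses\<close>

type_synonym cheese = "nat \<Rightarrow> complex \<times> real"

abbreviation ctr :: "cheese \<Rightarrow> nat \<Rightarrow> complex" where
  "ctr A n \<equiv> fst (A n)"

abbreviation rad :: "cheese \<Rightarrow> nat \<Rightarrow> real" where
  "rad A n \<equiv> snd (A n)"

text \<open>The space \<open>(\<complex> \<times> [0,\<infinity>))\<^sup>N\<close>. The library's disks satisfy \<open>ball a 0 = {}\<close> and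
  \<open>cball a 0 = {a}\<close>, as required for zero radii.\<close>

definition cheese_space :: "cheese set" where
  "cheese_space = {A. \<forall>n. 0 \<le> rad A n}"

definition S_set :: "cheese \<Rightarrow> nat set" where
  "S_set A = {n \<in> {1..}. rad A n > 0}"

definition X_set :: "cheese \<Rightarrow> complex set" where
  "X_set A = cball (ctr A 0) (rad A 0) - (\<Union>n\<in>{1..}. ball (ctr A n) (rad A n))"

text \<open>The quantities below are extended-real valued: a sum of non-negative terms is \<open>\<infinity>\<close> exactly
  when it diverges, and \<open>mu A = \<infinity>\<close> when the centres are unbounded. The latter can happen even
  for redundancy-free cheeses in \<open>N_set\<close>, since centres of zero-radius entries are unconstrained.\<close>

definition rho :: "cheese \<Rightarrow> ereal" where
  "rho A = (\<Sum>\<^sub>\<infinity>n\<in>{1..}. ereal (rad A n))"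

definition mu :: "cheese \<Rightarrow> ereal" where
  "mu A = (SUP n\<in>{1..}. ereal (cmod (ctr A n)))"

definition delta1 :: "cheese \<Rightarrow> ereal" where
  "delta1 A = ereal (rad A 0) - rho A"

definition H_set :: "cheese \<Rightarrow> complex set \<Rightarrow> nat set" where
  "H_set A E = {n \<in> S_set A. cball (ctr A n) (rad A n) \<inter> E \<noteq> {}}"

definition rho_on :: "complex set \<Rightarrow> cheese \<Rightarrow> ereal" where
  "rho_on E A = (\<Sum>\<^sub>\<infinity>n\<in>H_set A E. ereal (rad A n))"

definition classical :: "cheese \<Rightarrow> bool" where
  "classical A \<longleftrightarrow> rho A < \<infinity> \<and> rad A 0 > 0 \<and>
     (\<forall>k\<in>S_set A.
        cball (ctr A k) (rad A k) \<subseteq> ball (ctr A 0) (rad A 0) \<and>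
        (\<forall>l\<in>S_set A. l \<noteq> k \<longrightarrow> cball (ctr A k) (rad A k) \<inter> cball (ctr A l) (rad A l) = {}))"

definition redundancy_free :: "cheese \<Rightarrow> bool" where
  "redundancy_free A \<longleftrightarrow>
     (\<forall>k\<in>S_set A.
        ball (ctr A k) (rad A k) \<inter> cball (ctr A 0) (rad A 0) \<noteq> {} \<and>
        (\<forall>l\<in>S_set A. l \<noteq> k \<longrightarrow> \<not> ball (ctr A k) (rad A k) \<subseteq> ball (ctr A l) (rad A l)))"

definition N_set :: "cheese set" where
  "N_set = {A \<in> cheese_space. rho A < \<infinity> \<and> antimono_on {1..} (rad A)}"

definition N_bounded :: "ereal \<Rightarrow> ereal \<Rightarrow> cheese set" where
  "N_bounded M R = {B \<in> N_set. mu B \<le> M \<and> rho B \<le> R}"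

definition error_set :: "cheese \<Rightarrow> complex set" where
  "error_set A =
     (\<Union>m\<in>S_set A. \<Union>n\<in>S_set A - {m}. cball (ctr A m) (rad A m) \<inter> cball (ctr A n) (rad A n)) \<union>
     (\<Union>n\<in>S_set A. (- ball (ctr A 0) (rad A 0)) \<inter> cball (ctr A n) (rad A n))"

section \<open>Controlling collections of pairs\<close>

definition compact_plane_set :: "complex set \<Rightarrow> bool" where
  "compact_plane_set K \<longleftrightarrow> K \<noteq> {} \<and> compact K"

text \<open>A collection \<open>((K n, U n))\<close> indexed by \<open>n \<in> I\<close> is represented by \<open>I\<close> and two functions, whose
  values outside \<open>I\<close> are irrelevant.\<close>

definition controlling_collection ::
    "nat set \<Rightarrow> (nat \<Rightarrow> complex set) \<Rightarrow> (nat \<Rightarrow> complex set) \<Rightarrow> bool" where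
  "controlling_collection I K U \<longleftrightarrow>
     I \<noteq> {} \<and> I \<subseteq> {1..} \<and> (\<forall>n\<in>I. compact_plane_set (K n) \<and> open (U n) \<and> K n \<subseteq> U n)"

definition V_set :: "nat set \<Rightarrow> (nat \<Rightarrow> complex set) \<Rightarrow> complex set" where
  "V_set I U = (\<Union>n\<in>I. U n)"

definition F_set :: "nat set \<Rightarrow> (nat \<Rightarrow> complex set) \<Rightarrow> complex set" where
  "F_set I K = (\<Union>n\<in>I. K n)"

definition L_set ::
    "cheese \<Rightarrow> nat set \<Rightarrow> (nat \<Rightarrow> complex set) \<Rightarrow> (nat \<Rightarrow> complex set) \<Rightarrow> cheese set" where
  "L_set A I K U = {B \<in> N_bounded (mu A) (rho A).
     (\<forall>n\<in>I. rho_on (U n) B \<le> rho_on (U n) A) \<and>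
     cball (ctr B 0) (rad B 0) = cball (ctr A 0) (rad A 0) \<and>
     (\<forall>k\<in>S_set A. cball (ctr A k) (rad A k) \<inter> V_set I U = {} \<longrightarrow>
        (\<exists>l\<in>S_set B. ball (ctr B l) (rad B l) = ball (ctr A k) (rad A k))) \<and>
     (\<forall>n\<in>I. \<forall>k\<in>S_set A. cball (ctr A k) (rad A k) \<inter> U n \<noteq> {} \<longrightarrow>
        (\<exists>l\<in>S_set B. ball (ctr B l) (rad B l) = ball (ctr A k) (rad A k)) \<or>
        (\<exists>l\<in>H_set B (K n). ball (ctr A k) (rad A k) \<subseteq> ball (ctr B l) (rad B l)))}"

definition L_star ::
    "cheese \<Rightarrow> nat set \<Rightarrow> (nat \<Rightarrow> complex set) \<Rightarrow> (nat \<Rightarrow> complex set) \<Rightarrow> cheese set" where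
  "L_star A I K U = {B \<in> L_set A I K U. \<forall>B'\<in>L_set A I K U. delta1 B' \<le> delta1 B}"

definition nbhd :: "complex set \<Rightarrow> real \<Rightarrow> complex set" where
  "nbhd K M = {z. infdist z K < M}"

lemma controlling_collection_nbhd:
  assumes "I \<noteq> {}" "I \<subseteq> {1..}" "\<And>n. n \<in> I \<Longrightarrow> compact_plane_set (K n)" "\<And>n. n \<in> I \<Longrightarrow> M n > 0"
  shows "controlling_collection I K (\<lambda>n. nbhd (K n) (M n))"
proof -
  have "open (nbhd (K n) (M n))" for n
    unfolding nbhd_def by (intro open_Collect_less continuous_intros)
  then show ?thesis
    using assms by (auto simp: controlling_collection_def nbhd_def)
qed

end

(*
  Maximising delta1 over L_A means minimising the sum of the radii. Sorted competitors with centres in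
  a fixed bounded set form a compact set on which this sum is lower semicontinuous, so a minimiser
  exists; among the minimisers take one minimising the sum of s/(1+s) over the radii s. In such a B every
  disk is a disk of A or meets some K_n, since any other disk could be deleted. A disk meeting K_n has
  radius below M_n/2 and lies in U_n. If two disks of B had intersecting closures then, as E(A) is contained
  in the union of the K_n, both would be the same disk of A (delete one) or one would meet some K_n; then
  they can be replaced by one disk of radius s + t containing both, which stays in L_A, keeps the sum of
  the radii and decreases the second functional.
*)
theory Submission
  imports Defs
begin

section \<open>Sums of radii\<close>

text \<open>A disk containing two tangent disks has radius at least the sum of their radii, so a
  merger need not lower the sum of the radii and \<open>delta1\<close> alone cannot rule out
  tangency; hence the strictly subadditive tie-break. In a limit, mass can escape into ever smaller
  disks, so sums of radii are only lower semicontinuous. The numerical constraints are upper bounds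
  and survive. The existence clauses survive because a witness is at least as large as the disk of
  \<open>A\<close> it covers, and in a sorted cheese of bounded mass large disks have small indices.
  Deleting and merging disturb the order of the radii. They are therefore carried out on unsorted
  cheeses, and reordering, which changes no sum, comes last. The constant \<open>M n / 2\<close>
  turns a bound on radii into a bound \<open>M n\<close> on diameters. A merger keeps the sum of the
  radii of the disks meeting \<open>U n\<close>, so the estimate holds for the new disk too, and
  disjointness of the sets \<open>U n\<close> shields the other constraints.\<close>

lemma ereal_infsum:
  fixes f :: "'a \<Rightarrow> real"
  assumes "f summable_on J"
  shows "(\<Sum>\<^sub>\<infinity>n\<in>J. ereal (f n)) = ereal (infsum f J)"
proof -
  have "sum (ereal \<circ> f) F = ereal (sum f F)" for F
    by auto
  then have "infsum (ereal \<circ> f) J = ereal (infsum f J)"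
    by (simp add: infsum_comm_additive_general assms)
  then show ?thesis
    by (simp add: o_def)
qed

lemma summable_on_of_ereal_infsum:
  fixes f :: "'a \<Rightarrow> real"
  assumes nn: "\<And>n. n \<in> J \<Longrightarrow> 0 \<le> f n" and fin: "(\<Sum>\<^sub>\<infinity>n\<in>J. ereal (f n)) < \<infinity>"
  shows "f summable_on J"
proof (rule nonneg_bdd_above_summable_on)
  let ?s = "\<Sum>\<^sub>\<infinity>n\<in>J. ereal (f n)"
  have s: "ereal (sum f F) \<le> ?s" if "finite F" "F \<subseteq> J" for F
  proof -
    have "ereal (sum f F) = (\<Sum>\<^sub>\<infinity>n\<in>F. ereal (f n))"
      using that by simp
    also have "\<dots> \<le> ?s"
      by (rule infsum_mono_neutral) (use that nn in \<open>auto intro!: nonneg_summable_on_complete\<close>)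
    finally show ?thesis .
  qed
  have "0 \<le> ?s"
    using s[of "{}"] by (simp add: zero_ereal_def)
  then obtain c where "?s = ereal c"
    using fin by (cases ?s) auto
  then show "bdd_above (sum f ` {F. F \<subseteq> J \<and> finite F})"
    using s by (intro bdd_aboveI[of _ c]) auto
qed (use nn in auto)

lemma S_setD: "n \<in> S_set B \<Longrightarrow> 1 \<le> n \<and> 0 < rad B n"
  by (auto simp: S_set_def)

lemma H_set_subset: "H_set B E \<subseteq> S_set B"
  by (auto simp: H_set_def)

lemma H_set_UNIV [simp]: "H_set B UNIV = S_set B"
  by (auto simp: H_set_def S_set_def)

lemma H_set_mono: "E \<subseteq> E' \<Longrightarrow> H_set B E \<subseteq> H_set B E'"
  by (auto simp: H_set_def)

lemma rho_eq_rho_on_UNIV: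
  assumes "\<And>n. 0 \<le> rad B n"
  shows "rho B = rho_on UNIV B"
  unfolding rho_def rho_on_def H_set_UNIV
  by (rule infsum_cong_neutral) (use assms in \<open>force simp: S_set_def order.order_iff_strict\<close>)+

text \<open>For summable radii the identity as \<open>\<phi>\<close> gives the real value of
  \<open>rho_on\<close>, while \<open>conc\<close> gives the tie-breaking functional. Keeping
  \<open>\<phi>\<close> and \<open>E\<close> free lets merging, reordering and limits be treated
  once for both.\<close>

definition cost :: "(real \<Rightarrow> real) \<Rightarrow> complex set \<Rightarrow> cheese \<Rightarrow> real" where
  "cost \<phi> E B = (\<Sum>\<^sub>\<infinity>n\<in>H_set B E. \<phi> (rad B n))"

abbreviation mass :: "complex set \<Rightarrow> cheese \<Rightarrow> real" where
  "mass \<equiv> cost (\<lambda>x. x)"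

lemma summable_on_H_set:
  fixes f :: "nat \<Rightarrow> real"
  shows "f summable_on S_set B \<Longrightarrow> f summable_on H_set B E"
  by (rule summable_on_subset_banach[OF _ H_set_subset])

lemma rho_on_eq_mass: "rad B summable_on S_set B \<Longrightarrow> rho_on E B = ereal (mass E B)"
  unfolding rho_on_def cost_def by (rule ereal_infsum) (rule summable_on_H_set)

lemma rad_le_mass:
  assumes "\<And>n. 0 \<le> rad B n" "rad B summable_on S_set B" "n \<in> H_set B E"
  shows "rad B n \<le> mass E B"
  using finite_sum_le_infsum[of "rad B" "H_set B E" "{n}"] assms summable_on_H_set
  by (auto simp: cost_def)

text \<open>In sorted order the first \<open>n\<close> radii are each at least the
  \<open>n\<close>-th. The estimate turns a lower bound on a radius into an upper bound on its
  index.\<close>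

lemma mult_rad_le_mass:
  assumes nn: "\<And>n. 0 \<le> rad B n" and sm: "rad B summable_on S_set B"
    and anti: "antimono_on {1..} (rad B)" and n: "n \<ge> 1" "rad B n > 0"
  shows "real n * rad B n \<le> mass UNIV B"
proof -
  have le: "rad B n \<le> rad B i" if "i \<in> {1..n}" for i
    using monotone_onD[OF anti, of i n] that by auto
  have "real n * rad B n = (\<Sum>i\<in>{1..n}. rad B n)"
    by simp
  also have "\<dots> \<le> (\<Sum>i\<in>{1..n}. rad B i)"
    by (rule sum_mono) (rule le)
  also have "\<dots> \<le> mass UNIV B"
    unfolding cost_def H_set_UNIV
    by (rule finite_sum_le_infsum[OF sm])
       (use le n nn in \<open>auto simp: S_set_def intro: less_le_trans\<close>)
  finally show ?thesis .
qed

lemma cost_le_cost: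
  assumes sub: "H_set B' E \<subseteq> H_set B E" and eq: "\<And>n. n \<in> H_set B' E \<Longrightarrow> rad B' n = rad B n"
    and nn: "\<And>n. 0 \<le> \<phi> (rad B n)" and sm: "(\<lambda>n. \<phi> (rad B n)) summable_on S_set B"
  shows "cost \<phi> E B' \<le> cost \<phi> E B"
proof -
  have "cost \<phi> E B' = (\<Sum>\<^sub>\<infinity>n\<in>H_set B' E. \<phi> (rad B n))"
    unfolding cost_def by (rule infsum_cong) (simp add: eq)
  also have "\<dots> \<le> cost \<phi> E B"
    unfolding cost_def
    by (rule infsum_mono2) (use assms summable_on_H_set summable_on_subset_banach in blast)+
  finally show ?thesis .
qed

lemma infsum_remove:
  fixes f :: "'a \<Rightarrow> real"
  assumes "f summable_on J" "x \<in> J"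
  shows "infsum f J = f x + infsum f (J - {x})"
proof -
  have "f summable_on (J - {x})"
    using assms summable_on_subset_banach by blast
  then have "infsum f (insert x (J - {x})) = f x + infsum f (J - {x})"
    by (intro infsum_insert) auto
  then show ?thesis
    using assms by (simp add: insert_absorb)
qed

text \<open>The merged disk is stored at \<open>m\<close>, and \<open>l\<close> leaves
  \<open>S_set\<close> by getting radius zero, so only two summands change. With
  \<open>t = rad B l + rad B m\<close> the balance gives equality for the identity and a strict
  decrease for \<open>conc\<close>.\<close>

lemma cost_merge:
  fixes B :: cheese
  assumes sm: "(\<lambda>n. \<phi> (rad B n)) summable_on S_set B"
    and lm: "l \<in> H_set B E" "m \<in> H_set B E" "l \<noteq> m"
    and B': "B' = B(m := (c, t), l := (0, 0))" and m': "m \<in> H_set B' E"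
  shows "cost \<phi> E B' + \<phi> (rad B l) + \<phi> (rad B m) = cost \<phi> E B + \<phi> t"
    and "(\<lambda>n. \<phi> (rad B' n)) summable_on S_set B'"
proof -
  let ?J = "H_set B E - {l} - {m}"
  have J: "H_set B' E = insert m ?J"
    using m' lm by (auto simp: B' H_set_def S_set_def split: if_splits)
  have eq: "\<phi> (rad B' n) = \<phi> (rad B n)" if "n \<in> ?J" for n
    using that by (simp add: B')
  have smJ: "(\<lambda>n. \<phi> (rad B n)) summable_on ?J"
    by (rule summable_on_subset_banach[OF summable_on_H_set[OF sm, of E]]) auto
  have smJ': "(\<lambda>n. \<phi> (rad B' n)) summable_on ?J"
    using smJ by (rule summable_on_cong[THEN iffD2, rotated]) (rule eq)
  have m'_rad: "rad B' m = t"
    using lm by (simp add: B')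
  have "cost \<phi> E B' = \<phi> (rad B' m) + (\<Sum>\<^sub>\<infinity>n\<in>?J. \<phi> (rad B' n))"
    unfolding cost_def J by (rule infsum_insert[OF smJ']) auto
  also have "(\<Sum>\<^sub>\<infinity>n\<in>?J. \<phi> (rad B' n)) = (\<Sum>\<^sub>\<infinity>n\<in>?J. \<phi> (rad B n))"
    by (rule infsum_cong) (rule eq)
  finally have 1: "cost \<phi> E B' = \<phi> t + (\<Sum>\<^sub>\<infinity>n\<in>?J. \<phi> (rad B n))"
    using m'_rad by simp
  have 2: "cost \<phi> E B = \<phi> (rad B l) + (\<phi> (rad B m) + (\<Sum>\<^sub>\<infinity>n\<in>?J. \<phi> (rad B n)))"
    unfolding cost_def
    using infsum_remove[OF summable_on_H_set[OF sm], of l E]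
      infsum_remove[of "\<lambda>n. \<phi> (rad B n)" "H_set B E - {l}" m] lm
      summable_on_subset_banach[OF summable_on_H_set[OF sm, of E], of "H_set B E - {l}"]
    by auto
  show "cost \<phi> E B' + \<phi> (rad B l) + \<phi> (rad B m) = cost \<phi> E B + \<phi> t"
    using 1 2 by simp
  have "S_set B' = insert m (S_set B - {l} - {m})"
    using m' lm by (auto simp: B' H_set_def S_set_def split: if_splits)
  moreover have "(\<lambda>n. \<phi> (rad B' n)) summable_on (S_set B - {l} - {m})"
  proof -
    have "(\<lambda>n. \<phi> (rad B n)) summable_on (S_set B - {l} - {m})"
      by (rule summable_on_subset_banach[OF sm]) auto
    moreover have "\<phi> (rad B' n) = \<phi> (rad B n)" if "n \<in> S_set B - {l} - {m}" for n
      using that by (simp add: B')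
    ultimately show ?thesis
      using summable_on_cong[of "S_set B - {l} - {m}" "\<lambda>n. \<phi> (rad B' n)" "\<lambda>n. \<phi> (rad B n)"]
      by blast
  qed
  ultimately show "(\<lambda>n. \<phi> (rad B' n)) summable_on S_set B'"
    by (metis summable_on_insert_iff)
qed

text \<open>Take \<open>d\<close> on the segment from \<open>b\<close> to \<open>c\<close>, dividing
  it in the ratio \<open>t : s\<close>. The disk of radius \<open>s + t\<close> about
  \<open>d\<close> then contains the disks of radius \<open>s\<close> about \<open>b\<close> and
  \<open>t\<close> about \<open>c\<close>. Convexity of disks about the origin controls
  \<open>cmod d\<close>, so a merger respects every bound on the centres.\<close>

lemma enclosing_disc:
  fixes b c :: complex
  assumes "0 < s" "0 < t" "dist b c \<le> s + t"
  obtains d where "dist b d \<le> t" "dist c d \<le> s" "cmod d \<le> cmod b \<or> cmod d \<le> cmod c"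
proof -
  define u where "u = t / (s + t)"
  define d where "d = (1 - u) *\<^sub>R b + u *\<^sub>R c"
  have u: "0 \<le> u" "u \<le> 1" "1 - u = s / (s + t)"
    using assms by (auto simp: u_def field_simps)
  have "b - d = u *\<^sub>R (b - c)" "c - d = (1 - u) *\<^sub>R (c - b)"
    by (auto simp: d_def algebra_simps)
  then have "dist b d = \<bar>u\<bar> * dist b c" "dist c d = \<bar>1 - u\<bar> * dist b c"
    unfolding dist_norm by (simp_all only: norm_scaleR norm_minus_commute)
  then have "dist b d = u * dist b c" "dist c d = (1 - u) * dist b c"
    using u(1,2) by simp_all
  moreover have "u * dist b c \<le> u * (s + t)" "(1 - u) * dist b c \<le> (1 - u) * (s + t)"
    using u assms by (intro mult_left_mono; simp)+
  moreover have "u * (s + t) = t" "(1 - u) * (s + t) = s"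
    using assms by (simp_all only: u(3)) (simp_all add: u_def)
  moreover have "cmod d \<le> max (cmod b) (cmod c)"
  proof -
    have "convex (cball (0::complex) (max (cmod b) (cmod c)))"
      by simp
    then have "d \<in> cball 0 (max (cmod b) (cmod c))"
      unfolding d_def by (rule convexD) (use u in auto)
    then show ?thesis
      by simp
  qed
  ultimately show thesis
    using that[of d] by (auto simp: max_def split: if_splits)
qed

section \<open>Decreasing rearrangement\<close>

lemma finite_superlevel_summable:
  fixes f :: "nat \<Rightarrow> real"
  assumes sm: "f summable_on P" and pos: "\<And>n. n \<in> P \<Longrightarrow> 0 < f n" and e: "e > 0"
  shows "finite {n\<in>P. e \<le> f n}"
proof (rule ccontr)
  assume "infinite {n\<in>P. e \<le> f n}"
  moreover obtain N :: nat where N: "infsum f P < real N * e"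
    using reals_Archimedean3[OF e] by blast
  ultimately obtain F where F: "finite F" "card F = N" "F \<subseteq> {n\<in>P. e \<le> f n}"
    using infinite_arbitrarily_large by blast
  have "real N * e = (\<Sum>n\<in>F. e)"
    by (simp add: F)
  also have "\<dots> \<le> sum f F"
    using F by (intro sum_mono) auto
  also have "\<dots> \<le> infsum f P"
    by (rule finite_sum_le_infsum[OF sm]) (use F pos in \<open>auto intro: less_imp_le\<close>)
  finally show False
    using N by simp
qed

text \<open>Order \<open>P\<close> by decreasing value, ties broken by the smaller index. Each
  element has finitely many predecessors, since superlevel sets of a positive summable function are
  finite, so it has a rank. The ranks fill an initial segment \<open>J\<close> of the positive
  integers, finite or not according to \<open>P\<close>.\<close>

lemma decreasing_rearrangement:
  fixes f :: "nat \<Rightarrow> real"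
  assumes sm: "f summable_on P" and pos: "\<And>n. n \<in> P \<Longrightarrow> 0 < f n"
  obtains \<pi> :: "nat \<Rightarrow> nat" and J where "bij_betw \<pi> J P" "J \<subseteq> {1..}"
    "\<And>i j. 1 \<le> i \<Longrightarrow> i \<le> j \<Longrightarrow> j \<in> J \<Longrightarrow> i \<in> J"
    "\<And>i j. i \<in> J \<Longrightarrow> j \<in> J \<Longrightarrow> i \<le> j \<Longrightarrow> f (\<pi> j) \<le> f (\<pi> i)"
proof -
  define prec where "prec = (\<lambda>m n. f n < f m \<or> (f n = f m \<and> m < n))"
  define below where "below = (\<lambda>n. {m\<in>P. prec m n})"
  define rk where "rk = (\<lambda>n. Suc (card (below n)))"
  have fin: "finite (below n)" if "n \<in> P" for n
    by (rule finite_subset[OF _ finite_superlevel_summable[OF sm pos pos[OF that]]])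
       (auto simp: below_def prec_def)
  have trans: "prec a b \<Longrightarrow> prec b c \<Longrightarrow> prec a c" and irr: "\<not> prec a a"
    and tot: "a = b \<or> prec a b \<or> prec b a" for a b c
    by (auto simp: prec_def)
  have mono: "rk m < rk n" if "m \<in> P" "n \<in> P" "prec m n" for m n
  proof -
    have "below m \<subset> below n"
      using that trans irr[of m] by (auto simp: below_def psubset_eq)
    then show ?thesis
      using psubset_card_mono[OF fin[OF that(2)]] by (simp add: rk_def)
  qed
  have inj: "inj_on rk P"
    using mono tot by (metis inj_onI less_irrefl)
  have step: "\<exists>m\<in>P. rk m = Suc i" if n: "n \<in> P" "rk n = Suc (Suc i)" for n i
  proof -
    have ne: "below n \<noteq> {}"
      using n by (auto simp: rk_def)
    have fr: "finite (rk ` below n)" "rk ` below n \<noteq> {}"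
      using fin n ne by auto
    \<comment> \<open>The predecessor of largest rank is the immediate one: all other predecessors
      of \<open>n\<close> precede it.\<close>
    obtain m where m: "m \<in> below n" "rk m = Max (rk ` below n)"
      using Max_in[OF fr] by (metis imageE)
    have mP: "m \<in> P" "prec m n"
      using m by (auto simp: below_def)
    have "below n = insert m (below m)"
    proof (intro equalityI subsetI)
      fix x assume x: "x \<in> below n"
      then have "rk x \<le> rk m" "x \<in> P"
        using m fr by (auto simp: below_def)
      then show "x \<in> insert m (below m)"
        using tot[of x m] mono[of m x] mP by (auto simp: below_def)
    next
      fix x assume "x \<in> insert m (below m)"
      then show "x \<in> below n"
        using m mP trans by (auto simp: below_def)
    qed
    moreover have "m \<notin> below m"
      using irr by (auto simp: below_def)
    ultimately have "card (below n) = Suc (card (below m))"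
      using fin mP by simp
    then show ?thesis
      using n mP by (auto simp: rk_def)
  qed
  have down: "i \<in> rk ` P" if "1 \<le> i" "i \<le> j" "j \<in> rk ` P" for i j
    using that(2,1,3)
  proof (induction rule: inc_induct)
    case (step k)
    then have "Suc k \<in> rk ` P"
      by simp
    then show ?case
      using \<open>1 \<le> k\<close> \<open>\<And>n i. n \<in> P \<Longrightarrow> rk n = Suc (Suc i) \<Longrightarrow> \<exists>m\<in>P. rk m = Suc i\<close>[of _ "k - 1"]
      by (auto simp: image_iff) (metis Suc_pred)
  qed auto
  show thesis
  proof (rule that[of "inv_into P rk" "rk ` P"])
    show "bij_betw (inv_into P rk) (rk ` P) P"
      using inj by (simp add: bij_betw_inv_into inj_on_imp_bij_betw)
    show "rk ` P \<subseteq> {1..}"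
      by (auto simp: rk_def)
    show "i \<in> rk ` P" if "1 \<le> i" "i \<le> j" "j \<in> rk ` P" for i j
      using down that by blast
    show "f (inv_into P rk j) \<le> f (inv_into P rk i)" if "i \<in> rk ` P" "j \<in> rk ` P" "i \<le> j" for i j
      using that mono[of "inv_into P rk j" "inv_into P rk i"]
      by (force simp: prec_def inv_into_into f_inv_into_f)
  qed
qed

text \<open>Only disks of positive radius are listed. All remaining indices receive the degenerate
  disk \<open>(0, 0)\<close>, whose centre meets every norm bound, whatever the centres of the
  zero-radius entries of \<open>B\<close> were.\<close>

lemma sorted_cheese:
  assumes nn: "\<And>n. 0 \<le> rad B n" and sm: "rad B summable_on S_set B"
  obtains B' \<pi> where "B' 0 = B 0" "antimono_on {1..} (rad B')" "\<And>n. 0 \<le> rad B' n"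
    "bij_betw \<pi> (S_set B') (S_set B)" "\<And>n. n \<in> S_set B' \<Longrightarrow> B' n = B (\<pi> n)"
    "\<And>n. n \<ge> 1 \<Longrightarrow> n \<notin> S_set B' \<Longrightarrow> B' n = (0, 0)"
proof -
  have pos: "\<And>n. n \<in> S_set B \<Longrightarrow> 0 < rad B n"
    using S_setD by blast
  obtain \<pi> :: "nat \<Rightarrow> nat" and J where J: "bij_betw \<pi> J (S_set B)" "J \<subseteq> {1..}"
    "\<And>i j. 1 \<le> i \<Longrightarrow> i \<le> j \<Longrightarrow> j \<in> J \<Longrightarrow> i \<in> J"
    "\<And>i j. i \<in> J \<Longrightarrow> j \<in> J \<Longrightarrow> i \<le> j \<Longrightarrow> rad B (\<pi> j) \<le> rad B (\<pi> i)"
    by (rule decreasing_rearrangement[OF sm]) (erule pos, rule that)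
  define B' where "B' = (\<lambda>n. if n = 0 then B 0 else if n \<in> J then B (\<pi> n) else (0, 0))"
  have S: "S_set B' = J"
  proof -
    have "0 < rad B (\<pi> n)" if "n \<in> J" for n
      using bij_betwE[OF J(1)] that pos by blast
    then show ?thesis
      using J(2) by (auto simp: S_set_def B'_def split: if_splits)
  qed
  show thesis
  proof (rule that[of B' \<pi>])
    show "antimono_on {1..} (rad B')"
    proof (rule monotone_onI)
      fix i j :: nat assume "i \<in> {1..}" "j \<in> {1..}" "i \<le> j"
      then show "rad B' i \<ge> rad B' j"
        using J(3)[of i j] J(4)[of i j] nn by (auto simp: B'_def)
    qed
    show "B' n = B (\<pi> n)" if "n \<in> S_set B'" for n
      using that J(2) by (auto simp: S) (auto simp: B'_def)
    show "B' n = (0, 0)" if "n \<ge> 1" "n \<notin> S_set B'" for n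
      using that by (auto simp: S) (auto simp: B'_def)
  qed (use nn J S in \<open>auto simp: B'_def\<close>)
qed

lemma cost_reindex:
  assumes "bij_betw \<pi> (S_set B') (S_set B)" and eq: "\<And>n. n \<in> S_set B' \<Longrightarrow> B' n = B (\<pi> n)"
  shows "cost \<phi> E B' = cost \<phi> E B"
proof -
  have "bij_betw \<pi> (H_set B' E) (H_set B E)"
  proof (rule bij_betw_subset[OF assms(1) H_set_subset])
    show "\<pi> ` H_set B' E = H_set B E"
    proof
      show "\<pi> ` H_set B' E \<subseteq> H_set B E"
        using bij_betwE[OF assms(1)] eq by (auto simp: H_set_def)
      show "H_set B E \<subseteq> \<pi> ` H_set B' E"
      proof
        fix x assume x: "x \<in> H_set B E"
        then obtain n where "n \<in> S_set B'" "x = \<pi> n"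
          using assms(1) H_set_subset by (metis bij_betw_imp_surj_on imageE subsetD)
        then show "x \<in> \<pi> ` H_set B' E"
          using x eq by (auto simp: H_set_def)
      qed
    qed
  qed
  then have "(\<Sum>\<^sub>\<infinity>n\<in>H_set B' E. \<phi> (rad B (\<pi> n))) = cost \<phi> E B"
    unfolding cost_def by (rule infsum_reindex_bij_betw)
  moreover have "(\<Sum>\<^sub>\<infinity>n\<in>H_set B' E. \<phi> (rad B (\<pi> n))) = cost \<phi> E B'"
    unfolding cost_def by (rule infsum_cong) (use eq H_set_subset in \<open>metis subsetD\<close>)
  ultimately show ?thesis
    by simp
qed

section \<open>Semicontinuity and compactness\<close>

text \<open>Meeting an open set is stable under small changes of centre and radius, because a common
  point can be carried along with the disk.\<close>

lemma eventually_mem_H_set: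
  fixes Y :: "nat \<Rightarrow> cheese"
  assumes lim: "(\<lambda>j. Y j n) \<longlonglongrightarrow> B n" and "open V" and n: "n \<in> H_set B V"
  shows "\<forall>\<^sub>F j in sequentially. n \<in> H_set (Y j) V"
proof -
  have s: "n \<ge> 1" "rad B n > 0"
    using n by (auto simp: H_set_def S_set_def)
  obtain z where z: "z \<in> V" "dist (ctr B n) z \<le> rad B n"
    using n by (auto simp: H_set_def)
  have lc: "(\<lambda>j. ctr (Y j) n) \<longlonglongrightarrow> ctr B n" and lr: "(\<lambda>j. rad (Y j) n) \<longlonglongrightarrow> rad B n"
    using lim by (auto intro: tendsto_fst tendsto_snd)
  \<comment> \<open>The similarity taking the limit disk onto the \<open>j\<close>-th one sends
    \<open>z\<close> to \<open>w j\<close>, which tends to \<open>z\<close> and hence eventually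
    lies in \<open>V\<close>.\<close>
  define w where "w = (\<lambda>j. ctr (Y j) n + (rad (Y j) n / rad B n) *\<^sub>R (z - ctr B n))"
  have "w \<longlonglongrightarrow> ctr B n + (rad B n / rad B n) *\<^sub>R (z - ctr B n)"
    unfolding w_def by (intro tendsto_intros lc lr) (use s in auto)
  then have "w \<longlonglongrightarrow> z"
    using s by simp
  then have "\<forall>\<^sub>F j in sequentially. w j \<in> V"
    using z assms(2) topological_tendstoD by blast
  moreover have "\<forall>\<^sub>F j in sequentially. rad (Y j) n > 0"
    using lr s order_tendstoD(1) by blast
  ultimately show ?thesis
  proof eventually_elim
    case (elim j)
    have "dist (ctr (Y j) n) (w j) = rad (Y j) n * (cmod (z - ctr B n) / rad B n)"
      using elim s by (simp add: w_def dist_norm)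
    also have "\<dots> \<le> rad (Y j) n * 1"
      using elim s z by (intro mult_left_mono) (auto simp: dist_norm norm_minus_commute field_simps)
    finally show ?case
      using elim s by (auto simp: H_set_def S_set_def)
  qed
qed

text \<open>Fatou's argument: finitely many indices of \<open>H_set B V\<close> eventually belong to
  \<open>H_set (Y j) V\<close>, so each finite partial sum of the limit is at most \<open>L\<close>;
  summability follows from the same bound. A constant \<open>c\<close> serves for constraints,
  \<open>c j = cost \<phi> V (Y j)\<close> for the functionals to be minimised.\<close>

lemma cost_lsc:
  fixes Y :: "nat \<Rightarrow> cheese"
  assumes lim: "\<And>n. (\<lambda>j. Y j n) \<longlonglongrightarrow> B n" and V: "open V"
    and cont: "\<And>n. isCont \<phi> (rad B n)" and nn: "\<And>j n. 0 \<le> \<phi> (rad (Y j) n)"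
    and nnB: "\<And>n. 0 \<le> \<phi> (rad B n)"
    and sm: "\<And>j. (\<lambda>n. \<phi> (rad (Y j) n)) summable_on S_set (Y j)"
    and le: "\<And>j. cost \<phi> V (Y j) \<le> c j" and c: "c \<longlonglongrightarrow> L"
  shows "(\<lambda>n. \<phi> (rad B n)) summable_on H_set B V" "cost \<phi> V B \<le> L"
proof -
  have fin: "(\<Sum>n\<in>F. \<phi> (rad B n)) \<le> L" if F: "finite F" "F \<subseteq> H_set B V" for F
  proof (rule tendsto_le[OF sequentially_bot c])
    show "(\<lambda>j. \<Sum>n\<in>F. \<phi> (rad (Y j) n)) \<longlonglongrightarrow> (\<Sum>n\<in>F. \<phi> (rad B n))"
      by (intro tendsto_sum isCont_tendsto_compose[OF cont] tendsto_snd lim)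
    have "\<forall>\<^sub>F j in sequentially. \<forall>n\<in>F. n \<in> H_set (Y j) V"
      using F eventually_mem_H_set[where Y = Y and B = B, OF lim V] by (auto simp: eventually_ball_finite_distrib)
    then show "\<forall>\<^sub>F j in sequentially. (\<Sum>n\<in>F. \<phi> (rad (Y j) n)) \<le> c j"
    proof eventually_elim
      case (elim j)
      have "(\<Sum>n\<in>F. \<phi> (rad (Y j) n)) \<le> cost \<phi> V (Y j)"
        unfolding cost_def
        by (rule finite_sum_le_infsum[OF summable_on_H_set[OF sm] F(1)]) (use elim nn in auto)
      then show ?case
        using le[of j] by simp
    qed
  qed
  then show sm: "(\<lambda>n. \<phi> (rad B n)) summable_on H_set B V"
    by (intro nonneg_bdd_above_summable_on nnB bdd_aboveI[of _ L]) auto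
  show "cost \<phi> V B \<le> L"
    unfolding cost_def by (rule infsum_le_finite_sums[OF sm fin])
qed

section \<open>Lower semicontinuous minimisation on sequentially compact sets\<close>

lemma seq_compact_attains_lsc:
  fixes f :: "'a::first_countable_topology \<Rightarrow> real"
  assumes "seq_compact G" "G \<noteq> {}" and bdd: "\<And>x. x \<in> G \<Longrightarrow> 0 \<le> f x"
    and lsc: "\<And>X x c. (\<And>j. X j \<in> G) \<Longrightarrow> x \<in> G \<Longrightarrow> X \<longlonglongrightarrow> x \<Longrightarrow> (\<lambda>j. f (X j)) \<longlonglongrightarrow> c \<Longrightarrow> f x \<le> c"
  shows "\<exists>x\<in>G. \<forall>y\<in>G. f x \<le> f y"
proof -
  have b: "bdd_below (f ` G)"
    using bdd by (intro bdd_belowI[of _ 0]) auto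
  define m where "m = Inf (f ` G)"
  have "m \<in> closure (f ` G)"
    unfolding m_def using assms(2) b by (intro closure_contains_Inf) auto
  then obtain v where v: "\<And>j. v j \<in> f ` G" "v \<longlonglongrightarrow> m"
    unfolding closure_sequential by blast
  then have "\<forall>j. \<exists>x\<in>G. v j = f x"
    by blast
  then obtain X where X: "\<And>j. X j \<in> G" "\<And>j. v j = f (X j)"
    by metis
  then obtain x r where xr: "x \<in> G" "strict_mono r" "(X \<circ> r) \<longlonglongrightarrow> x"
    using assms(1) seq_compactE by metis
  have "(\<lambda>j. f ((X \<circ> r) j)) \<longlonglongrightarrow> m"
    using LIMSEQ_subseq_LIMSEQ[OF v(2) xr(2)] X by (simp add: o_def)
  then have "f x \<le> m"
    using lsc[of "X \<circ> r" x m] X xr by simp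
  then show ?thesis
    using xr(1) cInf_lower[OF _ b] m_def by (meson imageI order_trans)
qed

text \<open>Semicontinuity keeps limits of minimisers of \<open>f\<close> minimal, so these form a
  sequentially compact set on which \<open>g\<close> can be minimised in turn.\<close>

lemma seq_compact_attains_lsc_lex:
  fixes f g :: "'a::first_countable_topology \<Rightarrow> real"
  assumes G: "seq_compact G" "G \<noteq> {}" and bdd: "\<And>x. x \<in> G \<Longrightarrow> 0 \<le> f x" "\<And>x. x \<in> G \<Longrightarrow> 0 \<le> g x"
    and lf: "\<And>X x c. (\<And>j. X j \<in> G) \<Longrightarrow> x \<in> G \<Longrightarrow> X \<longlonglongrightarrow> x \<Longrightarrow> (\<lambda>j. f (X j)) \<longlonglongrightarrow> c \<Longrightarrow> f x \<le> c"
    and lg: "\<And>X x c. (\<And>j. X j \<in> G) \<Longrightarrow> x \<in> G \<Longrightarrow> X \<longlonglongrightarrow> x \<Longrightarrow> (\<lambda>j. g (X j)) \<longlonglongrightarrow> c \<Longrightarrow> g x \<le> c"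
  obtains x where "x \<in> G" "\<And>y. y \<in> G \<Longrightarrow> f x \<le> f y" "\<And>y. y \<in> G \<Longrightarrow> f y = f x \<Longrightarrow> g x \<le> g y"
proof -
  obtain x0 where x0: "x0 \<in> G" "\<And>y. y \<in> G \<Longrightarrow> f x0 \<le> f y"
    using seq_compact_attains_lsc[where f = f, OF G] bdd(1) lf by blast
  let ?G = "{x\<in>G. f x = f x0}"
  have "seq_compact ?G"
  proof (rule seq_compactI)
    fix X :: "nat \<Rightarrow> 'a" assume X: "\<forall>n. X n \<in> ?G"
    then obtain x r where xr: "x \<in> G" "strict_mono r" "(X \<circ> r) \<longlonglongrightarrow> x"
      using G(1) seq_compactE[of G X] by auto
    have "f x \<le> f x0"
      using lf[of "X \<circ> r" x "f x0"] X xr by simp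
    then have "x \<in> ?G"
      using x0(2) xr(1) by (simp add: order.antisym)
    then show "\<exists>x\<in>?G. \<exists>r. strict_mono r \<and> (X \<circ> r) \<longlonglongrightarrow> x"
      using xr by blast
  qed
  moreover have "?G \<noteq> {}"
    using x0 by blast
  ultimately have "\<exists>x\<in>?G. \<forall>y\<in>?G. g x \<le> g y"
    by (rule seq_compact_attains_lsc) (use bdd(2) lg in \<open>simp; blast\<close>)+
  then obtain x where x: "x \<in> ?G" "\<forall>y\<in>?G. g x \<le> g y"
    by blast
  show thesis
    by (rule that[of x]) (use x x0 in auto)
qed

text \<open>Tychonoff's theorem, with the box written as an extensional product over
  \<open>UNIV\<close>.\<close>

lemma compact_box:
  fixes S :: "nat \<Rightarrow> 'a::topological_space set"
  assumes "\<And>n. compact (S n)"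
  shows "compact {x. \<forall>n. x n \<in> S n}"
proof -
  have "{x. \<forall>n. x n \<in> S n} = PiE UNIV S"
    by auto
  moreover have "compactin (product_topology (\<lambda>i. euclidean) UNIV) (PiE UNIV S)"
    using assms by (simp add: compactin_PiE)
  ultimately show ?thesis
    using compactin_euclidean_iff by (metis euclidean_product_topology)
qed

lemma tendsto_coordinate:
  fixes X :: "nat \<Rightarrow> 'i \<Rightarrow> 'a::topological_space"
  assumes "X \<longlonglongrightarrow> x"
  shows "(\<lambda>j. X j n) \<longlonglongrightarrow> x n"
  using continuous_on_tendsto_compose[OF continuous_on_product_coordinates assms] by simp

lemma frequently_closed_limit:
  assumes "X \<longlonglongrightarrow> x" "closed W" "\<exists>\<^sub>F j in sequentially. X j \<in> W"
  shows "x \<in> W"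
proof (rule ccontr)
  assume "x \<notin> W"
  then have "\<forall>\<^sub>F j in sequentially. X j \<in> - W"
    using assms(1,2) topological_tendstoD[of X x sequentially "- W"] by (auto simp: open_Compl)
  then show False
    using assms(3) by (simp add: frequently_def)
qed

lemma infdist_le_iff_cball_Int:
  fixes K :: "complex set"
  assumes "compact K" "K \<noteq> {}"
  shows "infdist b K \<le> s \<longleftrightarrow> cball b s \<inter> K \<noteq> {}"
proof
  assume "infdist b K \<le> s"
  moreover obtain x where "x \<in> K" "infdist b K = dist b x"
    using infdist_attains_inf[OF compact_imp_closed[OF assms(1)] assms(2)] by metis
  ultimately show "cball b s \<inter> K \<noteq> {}"
    by auto
next
  assume "cball b s \<inter> K \<noteq> {}"
  then show "infdist b K \<le> s"
    using infdist_le2 by (metis Int_emptyI mem_cball)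
qed

text \<open>Deleting a disk means giving it radius zero. The centre is also reset to the origin, so
  that a deleted disk with a distant centre no longer violates a bound on the centres.\<close>

definition clear :: "nat set \<Rightarrow> cheese \<Rightarrow> cheese" where
  "clear Q B n = (if n \<in> Q then (0, 0) else B n)"

lemma H_set_clear: "H_set (clear Q B) E = H_set B E - Q"
  by (auto simp: H_set_def S_set_def clear_def)

lemma S_set_clear: "S_set (clear Q B) = S_set B - Q"
  using H_set_clear[of Q B UNIV] by simp

lemma rad_clear_summable:
  assumes "rad B summable_on S_set B"
  shows "rad (clear Q B) summable_on S_set (clear Q B)"
proof -
  have "rad B summable_on S_set (clear Q B)"
    by (rule summable_on_subset_banach[OF assms]) (auto simp: S_set_clear)
  moreover have "rad (clear Q B) n = rad B n" if "n \<in> S_set (clear Q B)" for n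
    using that by (auto simp: S_set_clear clear_def)
  ultimately show ?thesis
    using summable_on_cong[of "S_set (clear Q B)" "rad (clear Q B)" "rad B"] by blast
qed

lemma mass_clear_le:
  assumes "\<And>n. 0 \<le> rad B n" "rad B summable_on S_set B"
  shows "mass E (clear Q B) \<le> mass E B"
  by (rule cost_le_cost) (use assms in \<open>auto simp: H_set_clear\<close>, auto simp: clear_def)

lemma mass_clear_less:
  assumes nn: "\<And>n. 0 \<le> rad B n" and sm: "rad B summable_on S_set B" and l: "l \<in> S_set B"
  shows "mass UNIV (clear {l} B) < mass UNIV B"
proof -
  have "mass UNIV B = rad B l + infsum (rad B) (S_set B - {l})"
    unfolding cost_def H_set_UNIV by (rule infsum_remove[OF sm l])
  moreover have "mass UNIV (clear {l} B) = infsum (rad B) (S_set B - {l})"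
    unfolding cost_def H_set_UNIV S_set_clear by (rule infsum_cong) (auto simp: clear_def)
  ultimately show ?thesis
    using S_setD[OF l] by simp
qed

text \<open>Since the radii are sorted, a disk of radius at least \<open>r\<close> has index at most \<open>R / r\<close>, so
  one index serves for infinitely many \<open>j\<close>.\<close>

lemma limit_witness:
  fixes Y :: "nat \<Rightarrow> cheese"
  assumes lim: "\<And>n. (\<lambda>j. Y j n) \<longlonglongrightarrow> B n"
    and nn: "\<And>j n. 0 \<le> rad (Y j) n" and sm: "\<And>j. rad (Y j) summable_on S_set (Y j)"
    and anti: "\<And>j. antimono_on {1..} (rad (Y j))" and R: "\<And>j. mass UNIV (Y j) \<le> R"
    and W: "closed W" "r > 0" "\<And>d. d \<in> W \<Longrightarrow> r \<le> snd d"
    and ex: "\<And>j. \<exists>l\<ge>1. Y j l \<in> W"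
  shows "\<exists>l\<ge>1. B l \<in> W"
proof -
  define N where "N = nat \<lceil>R / r\<rceil>"
  have "\<exists>l\<in>{1..N}. Y j l \<in> W" for j
  proof -
    obtain l where l: "l \<ge> 1" "Y j l \<in> W"
      using ex by blast
    then have rl: "r \<le> rad (Y j) l"
      using W(3) by blast
    have "real l * r \<le> real l * rad (Y j) l"
      using rl by (simp add: mult_left_mono)
    also have "\<dots> \<le> R"
      using mult_rad_le_mass[where B = "Y j", OF nn sm anti l(1)] rl W(2) R[of j] by simp
    finally have "real l \<le> R / r"
      using W(2) by (simp add: field_simps)
    then have "l \<le> N"
      unfolding N_def by linarith
    then show ?thesis
      using l by auto
  qed
  then have "\<exists>\<^sub>F j in sequentially. \<exists>l\<in>{1..N}. Y j l \<in> W"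
    by (intro eventually_frequently) auto
  then obtain l where l: "l \<in> {1..N}" "\<exists>\<^sub>F j in sequentially. Y j l \<in> W"
    using frequently_bex_finite[of "{1..N}" "\<lambda>j l. Y j l \<in> W" sequentially] by auto
  then show ?thesis
    using frequently_closed_limit[OF lim W(1)] by auto
qed

text \<open>Merging two disks into one of radius \<open>s + t\<close> keeps the sum of radii; this strictly subadditive
  function detects such a merger and, unlike \<open>- x\<^sup>2\<close>, gives a lower semicontinuous sum by the same
  argument as for the radii.\<close>

abbreviation conc :: "real \<Rightarrow> real" where
  "conc \<equiv> \<lambda>x. x / (1 + x)"

lemma conc_strictly_subadditive:
  assumes "0 < s" "0 < t"
  shows "conc (s + t) < conc s + conc t"
proof -
  have "conc s + conc t - conc (s + t) = s * t * (s + t + 2) / ((1 + s) * (1 + t) * (1 + (s + t)))"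
  proof -
    have "1 + s \<noteq> 0" "1 + t \<noteq> 0" "1 + (s + t) \<noteq> 0"
      using assms by auto
    then show ?thesis
      by (simp add: divide_simps) algebra
  qed
  also have "\<dots> > 0"
    using assms by (intro divide_pos_pos mult_pos_pos add_pos_pos) auto
  finally show ?thesis
    by simp
qed

lemma conc_summable:
  fixes f :: "nat \<Rightarrow> real"
  assumes "f summable_on J" "\<And>n. 0 \<le> f n"
  shows "(\<lambda>n. conc (f n)) summable_on J"
proof (rule summable_on_comparison_test[OF assms(1)])
  show "conc (f n) \<le> f n" if "n \<in> J" for n
    using assms(2)[of n] by (simp add: divide_simps algebra_simps)
  show "0 \<le> conc (f n)" if "n \<in> J" for n
    using assms(2)[of n] by simp
qed

section \<open>Admissible cheeses\<close>

locale controlled_cheese =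
  fixes A :: cheese and I :: "nat set" and K U :: "nat \<Rightarrow> complex set" and M :: "nat \<Rightarrow> real"
  assumes A_N: "A \<in> N_set"
    and A_rf: "redundancy_free A"
    and I_ne: "I \<noteq> {}"
    and K_cps: "\<And>n. n \<in> I \<Longrightarrow> compact_plane_set (K n)"
    and M_pos: "\<And>n. n \<in> I \<Longrightarrow> M n > 0"
    and U_eq: "\<And>n. n \<in> I \<Longrightarrow> U n = nbhd (K n) (M n)"
    and U_sub: "\<And>n. n \<in> I \<Longrightarrow> U n \<subseteq> ball (ctr A 0) (rad A 0)"
    and rho_U: "\<And>n. n \<in> I \<Longrightarrow> rho_on (U n) A < ereal (M n / 2)"
    and U_disj: "\<And>n p. n \<in> I \<Longrightarrow> p \<in> I \<Longrightarrow> n \<noteq> p \<Longrightarrow> U n \<inter> U p = {}"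
    and err: "error_set A \<subseteq> F_set I K"
begin

lemma K: "n \<in> I \<Longrightarrow> compact (K n)" "n \<in> I \<Longrightarrow> K n \<noteq> {}"
  using K_cps by (auto simp: compact_plane_set_def)

lemma K_sub: "n \<in> I \<Longrightarrow> K n \<subseteq> U n"
  using M_pos by (auto simp: U_eq nbhd_def)

lemma U_open: "n \<in> I \<Longrightarrow> open (U n)"
  unfolding U_eq nbhd_def by (intro open_Collect_less continuous_intros)

lemma touch_iff: "n \<in> I \<Longrightarrow> infdist b (K n) \<le> s \<longleftrightarrow> cball b s \<inter> K n \<noteq> {}"
  by (rule infdist_le_iff_cball_Int[OF K])

lemma A_nonneg: "0 \<le> rad A n"
  using A_N by (auto simp: N_set_def cheese_space_def)

lemma A_summable: "rad A summable_on S_set A"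
proof (rule summable_on_of_ereal_infsum)
  have "rho_on UNIV A < \<infinity>"
    using A_N rho_eq_rho_on_UNIV A_nonneg by (metis (no_types, lifting) N_set_def mem_Collect_eq)
  then show "(\<Sum>\<^sub>\<infinity>n\<in>S_set A. ereal (rad A n)) < \<infinity>"
    by (simp add: rho_on_def)
qed (rule A_nonneg)

lemma rho_A: "rho A = ereal (mass UNIV A)"
  using rho_eq_rho_on_UNIV[of A] A_nonneg rho_on_eq_mass[OF A_summable] by simp

lemma mass_U_A: "n \<in> I \<Longrightarrow> mass (U n) A < M n / 2"
  using rho_U[of n] rho_on_eq_mass[OF A_summable, of "U n"] by simp

lemma rad_A0_pos: "0 < rad A 0"
proof -
  obtain n x where "n \<in> I" "x \<in> K n"
    using I_ne K by blast
  then have "x \<in> ball (ctr A 0) (rad A 0)"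
    using K_sub U_sub by blast
  then show ?thesis
    using zero_le_dist[of "ctr A 0" x] by (simp del: zero_le_dist)
qed

lemma mu_nonneg: "0 \<le> mu A"
proof -
  have "ereal (cmod (ctr A 1)) \<le> mu A"
    unfolding mu_def by (rule SUP_upper) auto
  then show ?thesis
    using order_trans[of 0 "ereal (cmod (ctr A 1))"] by simp
qed

text \<open>The pairs of centre and radius that can witness clause (d) for disk \<open>k\<close> of
  \<open>A\<close> and \<open>K n\<close>. For \<open>rad A k > 0\<close>, inclusion of disks is an
  inequality between distance and radii, and touching \<open>K n\<close> is one for
  \<open>infdist\<close>; in this form the set is closed.\<close>

definition cov :: "nat \<Rightarrow> nat \<Rightarrow> (complex \<times> real) set" where
  "cov n k = insert (A k)
     {d. dist (ctr A k) (fst d) + rad A k \<le> snd d \<and> infdist (fst d) (K n) \<le> snd d}"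

text \<open>Membership in \<open>L_set\<close> without the ordering of the radii, which deletions
  and mergers would violate. The comparison with \<open>mu A\<close> stays extended-real, since
  \<open>mu A\<close> may be infinite.\<close>

definition admissible :: "cheese \<Rightarrow> bool" where
  "admissible B \<longleftrightarrow> (\<forall>n. 0 \<le> rad B n) \<and> B 0 = A 0 \<and>
     (\<forall>n\<ge>1. ereal (cmod (ctr B n)) \<le> mu A) \<and>
     rad B summable_on S_set B \<and> mass UNIV B \<le> mass UNIV A \<and>
     (\<forall>n\<in>I. mass (U n) B \<le> mass (U n) A) \<and>
     (\<forall>k\<in>S_set A. cball (ctr A k) (rad A k) \<inter> V_set I U = {} \<longrightarrow> (\<exists>l\<ge>1. B l \<in> {A k})) \<and>
     (\<forall>n\<in>I. \<forall>k\<in>S_set A. cball (ctr A k) (rad A k) \<inter> U n \<noteq> {} \<longrightarrow> (\<exists>l\<ge>1. B l \<in> cov n k))"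

lemma admissibleD:
  assumes "admissible B"
  shows "0 \<le> rad B n" "B 0 = A 0" "n \<ge> 1 \<Longrightarrow> ereal (cmod (ctr B n)) \<le> mu A"
    "rad B summable_on S_set B" "mass UNIV B \<le> mass UNIV A"
    "n \<in> I \<Longrightarrow> mass (U n) B \<le> mass (U n) A"
    "k \<in> S_set A \<Longrightarrow> cball (ctr A k) (rad A k) \<inter> V_set I U = {} \<Longrightarrow> \<exists>l\<ge>1. B l \<in> {A k}"
    "n \<in> I \<Longrightarrow> k \<in> S_set A \<Longrightarrow> cball (ctr A k) (rad A k) \<inter> U n \<noteq> {} \<Longrightarrow> \<exists>l\<ge>1. B l \<in> cov n k"
  using assms unfolding admissible_def by blast+

lemma cov_rad: "d \<in> cov n k \<Longrightarrow> rad A k \<le> snd d"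
  using zero_le_dist[of "ctr A k" "fst d"] by (auto simp: cov_def simp del: zero_le_dist)

lemma closed_cov: "closed (cov n k)"
  unfolding cov_def by (intro closed_insert closed_Collect_conj closed_Collect_le continuous_intros)

lemma cov_dist: "d \<in> cov n k \<Longrightarrow> dist (ctr A k) (fst d) + rad A k \<le> snd d"
  by (auto simp: cov_def)

lemma admissible_A: "admissible A"
  unfolding admissible_def
proof (intro conjI ballI allI impI)
  show "ereal (cmod (ctr A n)) \<le> mu A" if "n \<ge> 1" for n
    unfolding mu_def by (rule SUP_upper) (use that in auto)
  show "\<exists>l\<ge>1. A l \<in> {A k}" if "k \<in> S_set A" for k
    using S_setD[OF that] by auto
  show "\<exists>l\<ge>1. A l \<in> cov n k" if "k \<in> S_set A" for n k
    using S_setD[OF that] by (auto simp: cov_def)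
qed (use A_nonneg A_summable in auto)

lemma ball_eq_disc_iff:
  "k \<in> S_set A \<Longrightarrow> ball (ctr B l) (rad B l) = ball (ctr A k) (rad A k) \<longleftrightarrow> B l = A k"
  using S_setD[of k A] by (auto simp: ball_eq_ball_iff prod_eq_iff)

lemma L_set_imp_admissible:
  assumes "B \<in> L_set A I K U"
  shows "admissible B" "antimono_on {1..} (rad B)" "rho B = ereal (mass UNIV B)"
proof -
  have B: "B \<in> N_set" "mu B \<le> mu A" "rho B \<le> rho A"
    "\<And>n. n \<in> I \<Longrightarrow> rho_on (U n) B \<le> rho_on (U n) A"
    "cball (ctr B 0) (rad B 0) = cball (ctr A 0) (rad A 0)"
    using assms by (auto simp: L_set_def N_bounded_def)
  show "antimono_on {1..} (rad B)"
    using B(1) by (simp add: N_set_def)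
  have nn: "0 \<le> rad B n" for n
    using B(1) by (auto simp: N_set_def cheese_space_def)
  have sm: "rad B summable_on S_set B"
  proof (rule summable_on_of_ereal_infsum)
    have "rho_on UNIV B < \<infinity>"
      using B(1) rho_eq_rho_on_UNIV nn by (metis (no_types, lifting) N_set_def mem_Collect_eq)
    then show "(\<Sum>\<^sub>\<infinity>n\<in>S_set B. ereal (rad B n)) < \<infinity>"
      by (simp add: rho_on_def)
  qed (rule nn)
  show rho: "rho B = ereal (mass UNIV B)"
    using rho_eq_rho_on_UNIV[of B] nn rho_on_eq_mass[OF sm] by simp
  show "admissible B"
    unfolding admissible_def
  proof (intro conjI ballI allI impI)
    show "B 0 = A 0"
      using B(5) A_nonneg[of 0] nn[of 0] by (auto simp: cball_eq_cball_iff prod_eq_iff)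
    show "ereal (cmod (ctr B n)) \<le> mu A" if "n \<ge> 1" for n
      using B(2) that unfolding mu_def[of B] SUP_le_iff by auto
    show "mass UNIV B \<le> mass UNIV A"
      using B(3) by (simp add: rho rho_A)
    show "mass (U n) B \<le> mass (U n) A" if "n \<in> I" for n
      using B(4)[OF that] by (simp add: rho_on_eq_mass A_summable sm)
    show "\<exists>l\<ge>1. B l \<in> {A k}"
      if k: "k \<in> S_set A" and "cball (ctr A k) (rad A k) \<inter> V_set I U = {}" for k
    proof -
      have "\<exists>l\<in>S_set B. ball (ctr B l) (rad B l) = ball (ctr A k) (rad A k)"
        using assms that by (auto simp: L_set_def)
      then show ?thesis
        using S_setD[of _ B] unfolding ball_eq_disc_iff[OF k] by blast
    qed
    show "\<exists>l\<ge>1. B l \<in> cov n k"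
      if n: "n \<in> I" and k: "k \<in> S_set A" and "cball (ctr A k) (rad A k) \<inter> U n \<noteq> {}" for n k
    proof -
      have "(\<exists>l\<in>S_set B. ball (ctr B l) (rad B l) = ball (ctr A k) (rad A k)) \<or>
        (\<exists>l\<in>H_set B (K n). ball (ctr A k) (rad A k) \<subseteq> ball (ctr B l) (rad B l))"
        using assms that by (auto simp: L_set_def)
      then show ?thesis
      proof
        assume "\<exists>l\<in>S_set B. ball (ctr B l) (rad B l) = ball (ctr A k) (rad A k)"
        then show ?thesis
          using k S_setD[of _ B] unfolding ball_eq_disc_iff[OF k] cov_def by blast
      next
        assume "\<exists>l\<in>H_set B (K n). ball (ctr A k) (rad A k) \<subseteq> ball (ctr B l) (rad B l)"
        then obtain l where l: "l \<in> H_set B (K n)"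
          "ball (ctr A k) (rad A k) \<subseteq> ball (ctr B l) (rad B l)"
          by blast
        then have "B l \<in> cov n k"
          using S_setD[OF k] touch_iff[OF n, of "ctr B l" "rad B l"]
          by (auto simp: cov_def ball_subset_ball_iff H_set_def)
        moreover have "l \<ge> 1"
          using l S_setD[of l B] H_set_subset by blast
        ultimately show ?thesis
          by blast
      qed
    qed
  qed (use nn sm in auto)
qed

lemma admissible_imp_L_set:
  assumes B: "admissible B" and anti: "antimono_on {1..} (rad B)"
  shows "B \<in> L_set A I K U" "rho B = ereal (mass UNIV B)"
proof -
  note nn = admissibleD(1)[OF B] and sm = admissibleD(4)[OF B]
  show rho: "rho B = ereal (mass UNIV B)"
    using rho_eq_rho_on_UNIV[of B] nn rho_on_eq_mass[OF sm] by simp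
  have S: "l \<in> S_set B" if "l \<ge> 1" "k \<in> S_set A" "rad A k \<le> rad B l" for l k
    using that S_setD[of k A] by (auto simp: S_set_def)
  show "B \<in> L_set A I K U"
    unfolding L_set_def mem_Collect_eq
  proof (intro conjI ballI impI)
    show "B \<in> N_bounded (mu A) (rho A)"
      using nn rho rho_A anti admissibleD(3,5)[OF B]
      by (auto simp: N_bounded_def N_set_def cheese_space_def mu_def[of B] SUP_le_iff)
    show "rho_on (U n) B \<le> rho_on (U n) A" if "n \<in> I" for n
      using admissibleD(6)[OF B that] by (simp add: rho_on_eq_mass A_summable sm)
    show "cball (ctr B 0) (rad B 0) = cball (ctr A 0) (rad A 0)"
      using admissibleD(2)[OF B] by simp
    show "\<exists>l\<in>S_set B. ball (ctr B l) (rad B l) = ball (ctr A k) (rad A k)"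
      if k: "k \<in> S_set A" and "cball (ctr A k) (rad A k) \<inter> V_set I U = {}" for k
      using admissibleD(7)[OF B that] S[OF _ k] unfolding ball_eq_disc_iff[OF k] by auto
    show "(\<exists>l\<in>S_set B. ball (ctr B l) (rad B l) = ball (ctr A k) (rad A k)) \<or>
        (\<exists>l\<in>H_set B (K n). ball (ctr A k) (rad A k) \<subseteq> ball (ctr B l) (rad B l))"
      if n: "n \<in> I" and k: "k \<in> S_set A" and ne: "cball (ctr A k) (rad A k) \<inter> U n \<noteq> {}" for n k
    proof -
      obtain l where l: "l \<ge> 1" "B l \<in> cov n k"
        using admissibleD(8)[OF B n k ne] by blast
      then have lS: "l \<in> S_set B"
        using S[OF _ k] cov_rad by blast
      show ?thesis
      proof (cases "B l = A k")
        case True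
        then have "ball (ctr B l) (rad B l) = ball (ctr A k) (rad A k)"
          by simp
        then show ?thesis
          using lS by blast
      next
        case False
        then have "dist (ctr A k) (ctr B l) + rad A k \<le> rad B l" "infdist (ctr B l) (K n) \<le> rad B l"
          using l by (auto simp: cov_def)
        then have "l \<in> H_set B (K n)" "ball (ctr A k) (rad A k) \<subseteq> ball (ctr B l) (rad B l)"
          using lS touch_iff[OF n] by (auto simp: H_set_def ball_subset_ball_iff)
        then show ?thesis
          by blast
      qed
    qed
  qed
qed

section \<open>Reordering, deletion and confinement of the centres\<close>

lemma admissible_sorted:
  assumes B: "admissible B" and C: "\<And>n. n \<ge> 1 \<Longrightarrow> cmod (ctr B n) \<le> C" "0 \<le> C"
  obtains B' where "admissible B'" "antimono_on {1..} (rad B')"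
    "\<And>n. n \<ge> 1 \<Longrightarrow> cmod (ctr B' n) \<le> C" "\<And>\<phi> E. cost \<phi> E B' = cost \<phi> E B"
proof -
  note nn = admissibleD(1)[OF B] and sm = admissibleD(4)[OF B]
  obtain B' \<pi> where B': "B' 0 = B 0" "antimono_on {1..} (rad B')" "\<And>n. 0 \<le> rad B' n"
    "bij_betw \<pi> (S_set B') (S_set B)" "\<And>n. n \<in> S_set B' \<Longrightarrow> B' n = B (\<pi> n)"
    "\<And>n. n \<ge> 1 \<Longrightarrow> n \<notin> S_set B' \<Longrightarrow> B' n = (0, 0)"
    by (rule sorted_cheese[OF nn sm]) (rule that)
  have cost: "cost \<phi> E B' = cost \<phi> E B" for \<phi> E
    by (rule cost_reindex[OF B'(4,5)])
  have \<pi>: "\<pi> n \<ge> 1" if "n \<in> S_set B'" for n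
    using bij_betwE[OF B'(4)] that S_setD by blast
  have wit: "\<exists>l\<ge>1. B' l \<in> W"
    if ex: "\<exists>l\<ge>1. B l \<in> W" and "\<And>d. d \<in> W \<Longrightarrow> rad A k \<le> snd d" "k \<in> S_set A" for W k
  proof -
    obtain l where l: "l \<ge> 1" "B l \<in> W"
      using ex by blast
    then have "l \<in> S_set B"
      using that(2)[OF l(2)] S_setD[OF that(3)] by (auto simp: S_set_def)
    then have "l \<in> \<pi> ` S_set B'"
      by (simp only: bij_betw_imp_surj_on[OF B'(4)])
    then obtain j where j: "j \<in> S_set B'" "\<pi> j = l"
      by (elim imageE) simp
    then have "B' j \<in> W" "j \<ge> 1"
      using l B'(5) S_setD by auto
    then show ?thesis
      by blast
  qed
  have "rad B' summable_on S_set B'"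
  proof -
    have "(\<lambda>n. rad B (\<pi> n)) summable_on S_set B'"
      using summable_on_reindex_bij_betw[OF B'(4), of "rad B"] sm by simp
    moreover have "rad B' n = rad B (\<pi> n)" if "n \<in> S_set B'" for n
      using that B'(5) by simp
    ultimately show ?thesis
      using summable_on_cong[of "S_set B'" "rad B'" "\<lambda>n. rad B (\<pi> n)"] by blast
  qed
  moreover have "ereal (cmod (ctr B' n)) \<le> mu A" if "n \<ge> 1" for n
    using that B'(5,6)[of n] \<pi>[of n] admissibleD(3)[OF B, of "\<pi> n"] mu_nonneg
    by (cases "n \<in> S_set B'") (auto simp flip: zero_ereal_def)
  moreover have "\<exists>l\<ge>1. B' l \<in> {A k}"
    if "k \<in> S_set A" "cball (ctr A k) (rad A k) \<inter> V_set I U = {}" for k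
    by (rule wit[OF admissibleD(7)[OF B that] _ that(1)]) auto
  moreover have "\<exists>l\<ge>1. B' l \<in> cov n k"
    if "n \<in> I" "k \<in> S_set A" "cball (ctr A k) (rad A k) \<inter> U n \<noteq> {}" for n k
    by (rule wit[OF admissibleD(8)[OF B that] cov_rad that(2)])
  ultimately have "admissible B'"
    using B' cost admissibleD(2,5,6)[OF B] unfolding admissible_def by simp
  moreover have "cmod (ctr B' n) \<le> C" if "n \<ge> 1" for n
    using that B'(5,6)[of n] \<pi>[of n] C by (cases "n \<in> S_set B'") auto
  ultimately show thesis
    using that B'(2) cost by blast
qed

text \<open>Deletion only lowers the sums, so just the existence clauses are at risk. They survive
  if every deleted witness has a copy outside \<open>Q\<close>; this covers both disks that witness
  nothing and one of two equal disks.\<close>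

lemma admissible_clear:
  assumes B: "admissible B" and Q: "0 \<notin> Q"
    and keep: "\<And>k l. k \<in> S_set A \<Longrightarrow> l \<in> Q \<Longrightarrow> B l = A k \<Longrightarrow> \<exists>m. m \<ge> 1 \<and> m \<notin> Q \<and> B m = B l"
    and cover: "\<And>n k l. n \<in> I \<Longrightarrow> k \<in> S_set A \<Longrightarrow> l \<in> Q \<Longrightarrow> B l \<in> cov n k \<Longrightarrow>
      \<exists>m. m \<ge> 1 \<and> m \<notin> Q \<and> B m = B l"
  shows "admissible (clear Q B)"
  unfolding admissible_def
proof (intro conjI ballI allI impI)
  show "0 \<le> rad (clear Q B) n" for n
    using admissibleD(1)[OF B] by (simp add: clear_def)
  show "clear Q B 0 = A 0"
    using admissibleD(2)[OF B] Q by (simp add: clear_def)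
  show "ereal (cmod (ctr (clear Q B) n)) \<le> mu A" if "n \<ge> 1" for n
    using admissibleD(3)[OF B that] mu_nonneg by (auto simp: clear_def simp flip: zero_ereal_def)
  show "rad (clear Q B) summable_on S_set (clear Q B)"
    by (rule rad_clear_summable[OF admissibleD(4)[OF B]])
  show "mass UNIV (clear Q B) \<le> mass UNIV A"
    using mass_clear_le[OF admissibleD(1,4)[OF B]] admissibleD(5)[OF B] order_trans by blast
  show "mass (U n) (clear Q B) \<le> mass (U n) A" if "n \<in> I" for n
    using mass_clear_le[OF admissibleD(1,4)[OF B]] admissibleD(6)[OF B that] order_trans by blast
  show "\<exists>l\<ge>1. clear Q B l \<in> {A k}"
    if k: "k \<in> S_set A" "cball (ctr A k) (rad A k) \<inter> V_set I U = {}" for k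
  proof -
    obtain l where l: "l \<ge> 1" "B l = A k"
      using admissibleD(7)[OF B k] by blast
    then obtain m where "m \<ge> 1" "m \<notin> Q" "B m = B l"
      using keep[OF k(1), of l] by blast
    then have "clear Q B m \<in> {A k}"
      using l(2) by (simp add: clear_def)
    then show ?thesis
      using \<open>m \<ge> 1\<close> by blast
  qed
  show "\<exists>l\<ge>1. clear Q B l \<in> cov n k"
    if k: "n \<in> I" "k \<in> S_set A" "cball (ctr A k) (rad A k) \<inter> U n \<noteq> {}" for n k
  proof -
    obtain l where l: "l \<ge> 1" "B l \<in> cov n k"
      using admissibleD(8)[OF B k] by blast
    then obtain m where "m \<ge> 1" "m \<notin> Q" "B m = B l"
      using cover[OF k(1,2), of l] by blast
    then have "clear Q B m \<in> cov n k"
      using l(2) by (simp add: clear_def)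
    then show ?thesis
      using \<open>m \<ge> 1\<close> by blast
  qed
qed

text \<open>Confining the centres to a bounded disk gives compactness also when \<open>mu A = \<infinity>\<close>, which happens
  if the centres of the zero-radius entries of \<open>A\<close> are unbounded.\<close>

definition bound :: real where
  "bound = cmod (ctr A 0) + rad A 0 + mass UNIV A"

lemma mass_nonneg: "admissible B \<Longrightarrow> 0 \<le> mass E B"
  unfolding cost_def by (rule infsum_nonneg) (use admissibleD(1) in blast)

lemma bound_nonneg: "0 \<le> bound"
  using mass_nonneg[OF admissible_A] A_nonneg by (simp add: bound_def)

lemma rad_le:
  assumes B: "admissible B" and l: "l \<ge> 1"
  shows "rad B l \<le> mass UNIV A"
proof (cases "l \<in> S_set B")
  case True
  then show ?thesis
    using rad_le_mass[OF admissibleD(1,4)[OF B], where E = UNIV] admissibleD(5)[OF B] by force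
next
  case False
  then have "rad B l \<le> 0"
    using l by (auto simp: S_set_def)
  then show ?thesis
    using mass_nonneg[OF admissible_A, of UNIV] by simp
qed

text \<open>The path from the origin through \<open>ctr A 0\<close> and the common point
  \<open>x\<close> to \<open>ctr B l\<close> accounts for the three terms of \<open>bound\<close>, a
  single radius being at most the mass of \<open>A\<close>.\<close>

lemma cmod_le_bound:
  assumes B: "admissible B" and l: "l \<ge> 1" and x: "x \<in> cball (ctr A 0) (rad A 0)" "x \<in> cball (ctr B l) (rad B l)"
  shows "cmod (ctr B l) \<le> bound"
proof -
  have "cmod (ctr B l) \<le> cmod (ctr A 0) + dist (ctr A 0) x + dist (ctr B l) x"
    using norm_triangle_ineq[of "ctr A 0" "ctr B l - ctr A 0"] dist_triangle2[of "ctr B l" "ctr A 0" x]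
    by (simp add: dist_norm norm_minus_commute)
  then show ?thesis
    using x rad_le[OF B l] by (simp add: bound_def)
qed

text \<open>A disk centred beyond \<open>bound\<close> misses the closed outer disk. Disks of
  \<open>A\<close> meet it by redundancy-freeness, and disks touching some \<open>K n\<close> meet
  it because \<open>K n\<close> lies inside, so the distant disks witness nothing and can be deleted
  before sorting.\<close>

lemma bounded_sorted:
  assumes B: "admissible B"
  obtains B' where "admissible B'" "antimono_on {1..} (rad B')"
    "\<And>n. n \<ge> 1 \<Longrightarrow> cmod (ctr B' n) \<le> bound" "mass UNIV B' \<le> mass UNIV B"
proof -
  define Q where "Q = {n. n \<ge> 1 \<and> cmod (ctr B n) > bound}"
  have keep: False if k: "k \<in> S_set A" and l: "l \<in> Q" "B l = A k" for k l
  proof -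
    have "ball (ctr A k) (rad A k) \<inter> cball (ctr A 0) (rad A 0) \<noteq> {}"
      using A_rf k by (auto simp: redundancy_free_def)
    then have "cball (ctr B l) (rad B l) \<inter> cball (ctr A 0) (rad A 0) \<noteq> {}"
      unfolding l(2) using ball_subset_cball by blast
    then obtain x where "x \<in> cball (ctr A 0) (rad A 0)" "x \<in> cball (ctr B l) (rad B l)"
      by blast
    then show False
      using cmod_le_bound[OF B] l(1) by (force simp: Q_def)
  qed
  have cover: False if n: "n \<in> I" and k: "k \<in> S_set A" and l: "l \<in> Q" "B l \<in> cov n k" for n k l
  proof (cases "B l = A k")
    case False
    then have "infdist (ctr B l) (K n) \<le> rad B l"
      using l by (auto simp: cov_def)
    then obtain x where "x \<in> K n" "x \<in> cball (ctr B l) (rad B l)"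
      using touch_iff[OF n] by blast
    moreover have "K n \<subseteq> cball (ctr A 0) (rad A 0)"
      using K_sub[OF n] U_sub[OF n] ball_subset_cball by blast
    ultimately show False
      using cmod_le_bound[OF B] l(1) by (force simp: Q_def)
  qed (use keep k l in blast)
  have adm: "admissible (clear Q B)"
  proof (rule admissible_clear[OF B])
    show "0 \<notin> Q"
      by (simp add: Q_def)
  qed (use keep cover in blast)+
  have "cmod (ctr (clear Q B) n) \<le> bound" if "n \<ge> 1" for n
    using that bound_nonneg by (auto simp: clear_def Q_def)
  then obtain B' where "admissible B'" "antimono_on {1..} (rad B')"
    "\<And>n. n \<ge> 1 \<Longrightarrow> cmod (ctr B' n) \<le> bound" "\<And>\<phi> E. cost \<phi> E B' = cost \<phi> E (clear Q B)"
    by (rule admissible_sorted[OF adm _ bound_nonneg]) (assumption, rule that)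
  then show thesis
    using that[of B'] mass_clear_le[OF admissibleD(1,4)[OF B], of UNIV Q] by simp
qed

section \<open>Compactness of the candidates and existence of an optimum\<close>

definition candidates :: "cheese set" where
  "candidates = {B. admissible B \<and> antimono_on {1..} (rad B) \<and> (\<forall>n\<ge>1. cmod (ctr B n) \<le> bound)}"

text \<open>Upper bounds on sums survive by semicontinuity, where openness of \<open>U n\<close>
  enters; witnesses survive because \<open>{A k}\<close> and \<open>cov n k\<close> are closed and
  force a radius of at least \<open>rad A k > 0\<close>.\<close>

lemma candidate_limit:
  assumes Y: "\<And>j. Y j \<in> candidates" and lim: "\<And>n. (\<lambda>j. Y j n) \<longlonglongrightarrow> B n"
  shows "B \<in> candidates"
proof -
  have adm: "admissible (Y j)" and anti: "antimono_on {1..} (rad (Y j))"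
    and bd: "\<And>n. n \<ge> 1 \<Longrightarrow> cmod (ctr (Y j) n) \<le> bound" for j
    using Y by (auto simp: candidates_def)
  have lc: "(\<lambda>j. ctr (Y j) n) \<longlonglongrightarrow> ctr B n" and lr: "(\<lambda>j. rad (Y j) n) \<longlonglongrightarrow> rad B n" for n
    using lim[of n] by (auto intro: tendsto_fst tendsto_snd)
  have nn: "0 \<le> rad B n" for n
    using LIMSEQ_le_const[OF lr] admissibleD(1)[OF adm] by blast
  have mass_le: "mass E B \<le> R" and sm_E: "rad B summable_on H_set B E"
    if "open E" "\<And>j. mass E (Y j) \<le> R" for E R
    using cost_lsc[where Y = Y and c = "\<lambda>_. R" and L = R and B = B and V = E and \<phi> = "\<lambda>x. x"]
      that lim nn admissibleD(1,4)[OF adm] by simp_all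
  have "B 0 = A 0"
    using LIMSEQ_unique[OF lim[of 0]] admissibleD(2)[OF adm] by simp
  moreover have "cmod (ctr B n) \<le> bound" if "n \<ge> 1" for n
    using LIMSEQ_le_const2[OF tendsto_norm[OF lc]] bd[OF that] by blast
  moreover have "ereal (cmod (ctr B n)) \<le> mu A" if "n \<ge> 1" for n
    using LIMSEQ_le_const2[OF tendsto_ereal[OF tendsto_norm[OF lc]]] admissibleD(3)[OF adm that] by blast
  moreover have "antimono_on {1..} (rad B)"
  proof (rule monotone_onI)
    fix i j :: nat assume "i \<in> {1..}" "j \<in> {1..}" "i \<le> j"
    then show "rad B i \<ge> rad B j"
      using LIMSEQ_le[OF lr lr] monotone_onD[OF anti] by blast
  qed
  moreover have "rad B summable_on S_set B" "mass UNIV B \<le> mass UNIV A"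
    using mass_le[of UNIV] sm_E[of UNIV] admissibleD(5)[OF adm] by auto
  moreover have "mass (U n) B \<le> mass (U n) A" if "n \<in> I" for n
    using mass_le[OF U_open] admissibleD(6)[OF adm] that by blast
  moreover have "\<exists>l\<ge>1. B l \<in> {A k}"
    if "k \<in> S_set A" "cball (ctr A k) (rad A k) \<inter> V_set I U = {}" for k
    by (rule limit_witness[OF lim admissibleD(1,4)[OF adm] anti admissibleD(5)[OF adm],
          where r = "rad A k"])
       (use admissibleD(7)[OF adm that] S_setD[OF that(1)] in auto)
  moreover have "\<exists>l\<ge>1. B l \<in> cov n k"
    if "n \<in> I" "k \<in> S_set A" "cball (ctr A k) (rad A k) \<inter> U n \<noteq> {}" for n k
    by (rule limit_witness[OF lim admissibleD(1,4)[OF adm] anti admissibleD(5)[OF adm] closed_cov,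
          where r = "rad A k"])
       (use admissibleD(8)[OF adm that] S_setD[OF that(2)] cov_rad in auto)
  ultimately show ?thesis
    unfolding candidates_def admissible_def using nn by blast
qed

lemma seq_compact_candidates: "seq_compact candidates"
proof (rule seq_compactI)
  fix X :: "nat \<Rightarrow> cheese" assume X: "\<forall>j. X j \<in> candidates"
  \<comment> \<open>Coordinate \<open>0\<close> is fixed, and the bounds on the other centres and
    radii place all candidates in one compact box.\<close>
  define S where "S = (\<lambda>n::nat. if n = 0 then {A 0} else cball 0 bound \<times> {0..mass UNIV A})"
  have "compact (S n)" for n
    by (auto simp: S_def intro: compact_Times)
  then have box: "seq_compact {x. \<forall>n. x n \<in> S n}"
    using compact_box compact_imp_seq_compact by blast
  have XS: "X j n \<in> S n" for j n
  proof (cases "n = 0")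
    case True
    then show ?thesis
      using X admissibleD(2) by (simp add: S_def candidates_def)
  next
    case False
    have "admissible (X j)" "cmod (ctr (X j) n) \<le> bound"
      using X False by (auto simp: candidates_def)
    then show ?thesis
      using False rad_le[of "X j" n] admissibleD(1)[of "X j" n] by (simp add: S_def mem_Times_iff)
  qed
  then have "\<forall>j. X j \<in> {x. \<forall>n. x n \<in> S n}"
    by simp
  then obtain B r where r: "strict_mono r" "(X \<circ> r) \<longlonglongrightarrow> B"
    by (rule seq_compactE[OF box]) (rule that)
  have "B \<in> candidates"
    using candidate_limit[of "X \<circ> r"] X tendsto_coordinate[OF r(2)] by simp
  then show "\<exists>B\<in>candidates. \<exists>r. strict_mono r \<and> (X \<circ> r) \<longlonglongrightarrow> B"
    using r by blast
qed

lemma optimal_candidate: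
  obtains B where "B \<in> candidates" "\<And>B'. admissible B' \<Longrightarrow> mass UNIV B \<le> mass UNIV B'"
    "\<And>B'. admissible B' \<Longrightarrow> (\<And>n. n \<ge> 1 \<Longrightarrow> cmod (ctr B' n) \<le> bound) \<Longrightarrow>
      mass UNIV B' = mass UNIV B \<Longrightarrow> cost conc UNIV B \<le> cost conc UNIV B'"
proof -
  have ne: "candidates \<noteq> {}"
    using bounded_sorted[OF admissible_A] by (auto simp: candidates_def)
  have adm: "admissible B" if "B \<in> candidates" for B
    using that by (simp add: candidates_def)
  have lsc: "cost \<phi> UNIV B \<le> c"
    if "\<And>j. X j \<in> candidates" "B \<in> candidates" "X \<longlonglongrightarrow> B" "(\<lambda>j. cost \<phi> UNIV (X j)) \<longlonglongrightarrow> c"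
      and \<phi>: "\<phi> = (\<lambda>x. x) \<or> \<phi> = conc" for X B c \<phi>
  proof (rule cost_lsc(2)[where Y = X and c = "\<lambda>j. cost \<phi> UNIV (X j)"])
    have nn: "0 \<le> rad (X j) n" "0 \<le> rad B n" for j n
      using admissibleD(1) adm that(1,2) by blast+
    show "0 \<le> \<phi> (rad (X j) n)" "0 \<le> \<phi> (rad B n)" for j n
      using \<phi> nn by auto
    show "isCont \<phi> (rad B n)" for n
      using \<phi> nn(2)[of n] by (auto intro!: continuous_intros)
    show "(\<lambda>n. \<phi> (rad (X j) n)) summable_on S_set (X j)" for j
      using \<phi> conc_summable[OF admissibleD(4)[OF adm[OF that(1)]] nn(1)]
        admissibleD(4)[OF adm[OF that(1)]] by blast
  qed (use that tendsto_coordinate[OF that(3)] in auto)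
  have conc_nn: "0 \<le> cost conc UNIV B" if "B \<in> candidates" for B
    unfolding cost_def by (rule infsum_nonneg) (use admissibleD(1)[OF adm[OF that]] in simp)
  obtain B where B: "B \<in> candidates" "\<And>y. y \<in> candidates \<Longrightarrow> mass UNIV B \<le> mass UNIV y"
    "\<And>y. y \<in> candidates \<Longrightarrow> mass UNIV y = mass UNIV B \<Longrightarrow> cost conc UNIV B \<le> cost conc UNIV y"
  proof (rule seq_compact_attains_lsc_lex[OF seq_compact_candidates ne,
        where f = "mass UNIV" and g = "cost conc UNIV"])
    show "0 \<le> mass UNIV B" if "B \<in> candidates" for B
      by (rule mass_nonneg[OF adm[OF that]])
    show "mass UNIV B \<le> c"
      if "\<And>j. X j \<in> candidates" "B \<in> candidates" "X \<longlonglongrightarrow> B" "(\<lambda>j. mass UNIV (X j)) \<longlonglongrightarrow> c" for X B c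
      using lsc[OF that] by blast
    show "cost conc UNIV B \<le> c"
      if "\<And>j. X j \<in> candidates" "B \<in> candidates" "X \<longlonglongrightarrow> B"
        "(\<lambda>j. cost conc UNIV (X j)) \<longlonglongrightarrow> c" for X B c
      using lsc[OF that] by blast
  qed (erule conc_nn, rule that)
  show thesis
  proof (rule that[OF B(1)])
    fix B' assume adm': "admissible B'"
    \<comment> \<open>Minimality extends from candidates to all admissible cheeses, since deleting
      distant disks and sorting does not raise the mass.\<close>
    show "mass UNIV B \<le> mass UNIV B'"
    proof (rule bounded_sorted[OF adm'])
      fix B'' assume "admissible B''" "antimono_on {1..} (rad B'')"
        "\<And>n. n \<ge> 1 \<Longrightarrow> cmod (ctr B'' n) \<le> bound" "mass UNIV B'' \<le> mass UNIV B'"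
      then show ?thesis
        using B(2)[of B''] by (simp add: candidates_def)
    qed
    assume bd: "\<And>n. n \<ge> 1 \<Longrightarrow> cmod (ctr B' n) \<le> bound" and eq: "mass UNIV B' = mass UNIV B"
    \<comment> \<open>With the centres already bounded, sorting suffices, and it leaves both
      functionals unchanged.\<close>
    obtain B'' where B'': "admissible B''" "antimono_on {1..} (rad B'')"
      "\<And>n. n \<ge> 1 \<Longrightarrow> cmod (ctr B'' n) \<le> bound" "\<And>\<phi> E. cost \<phi> E B'' = cost \<phi> E B'"
      by (rule admissible_sorted[OF adm' bd bound_nonneg]) (assumption, rule that)
    then have "B'' \<in> candidates"
      by (simp add: candidates_def)
    then show "cost conc UNIV B \<le> cost conc UNIV B'"
      using B(3)[of B''] eq B''(4) by simp
  qed
qed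

section \<open>Merging two intersecting disks\<close>

text \<open>Such a disk is counted in the sum over \<open>U n\<close>, so its diameter is below
  \<open>M n\<close>, and it contains a point of \<open>K n\<close>. The hypotheses are weaker than
  \<open>admissible\<close> because a merged cheese needs the conclusion before its admissibility is
  known.\<close>

lemma touching_disc_subset:
  assumes nn: "\<And>n. 0 \<le> rad B n" and sm: "rad B summable_on S_set B"
    and mass: "mass (U n) B \<le> mass (U n) A" and n: "n \<in> I" and l: "l \<in> H_set B (K n)"
  shows "cball (ctr B l) (rad B l) \<subseteq> U n"
proof
  fix z assume z: "z \<in> cball (ctr B l) (rad B l)"
  obtain x where x: "x \<in> K n" "dist (ctr B l) x \<le> rad B l"
    using l by (auto simp: H_set_def)
  have "l \<in> H_set B (U n)"
    using l H_set_mono[OF K_sub[OF n]] by blast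
  then have "rad B l < M n / 2"
    using rad_le_mass[OF nn sm] mass mass_U_A[OF n] by fastforce
  moreover have "infdist z (K n) \<le> dist z x"
    using x by (intro infdist_le)
  moreover have "dist z x \<le> dist (ctr B l) z + dist (ctr B l) x"
    by (rule dist_triangle3)
  ultimately show "z \<in> U n"
    using z x by (simp add: U_eq[OF n] nbhd_def)
qed

lemma admissible_touching_disc_subset:
  assumes B: "admissible B" and n: "n \<in> I" and l: "l \<in> H_set B (K n)"
  shows "cball (ctr B l) (rad B l) \<subseteq> U n"
  by (rule touching_disc_subset[OF admissibleD(1,4)[OF B] admissibleD(6)[OF B n] n l])

lemma index_of_U: "n \<in> I \<Longrightarrow> p \<in> I \<Longrightarrow> z \<in> U n \<Longrightarrow> z \<in> U p \<Longrightarrow> p = n"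
  using U_disj[of n p] by blast

text \<open>Disk \<open>m\<close> touches \<open>K n\<close> and so lies in \<open>U n\<close>; disk
  \<open>l\<close> shares \<open>z\<close> with it and is counted in the same sum, hence the merger
  changes neither the total nor the sum over \<open>U n\<close>. The new disk contains disk
  \<open>m\<close>, still touches \<open>K n\<close> and therefore again lies in \<open>U n\<close>,
  away from every other \<open>U p\<close>.\<close>

lemma admissible_merge:
  assumes B: "admissible B" and n: "n \<in> I"
    and l: "l \<in> S_set B" and m: "m \<in> H_set B (K n)" and lm: "l \<noteq> m"
    and z: "z \<in> cball (ctr B l) (rad B l)" "z \<in> cball (ctr B m) (rad B m)"
    and t: "t = rad B l + rad B m"
    and d: "dist (ctr B l) d \<le> rad B m" "dist (ctr B m) d \<le> rad B l"
      "cmod d \<le> cmod (ctr B l) \<or> cmod d \<le> cmod (ctr B m)"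
    and B': "B' = B(m := (d, t), l := (0, 0))"
  shows "admissible B'" "mass UNIV B' = mass UNIV B" "cost conc UNIV B' < cost conc UNIV B"
proof -
  note nn = admissibleD(1)[OF B] and sm = admissibleD(4)[OF B]
  have mS: "m \<in> S_set B"
    using m H_set_subset by blast
  have pos: "l \<ge> 1" "m \<ge> 1" "rad B l > 0" "rad B m > 0"
    using S_setD[OF l] S_setD[OF mS] by auto
  have mU: "cball (ctr B m) (rad B m) \<subseteq> U n"
    by (rule admissible_touching_disc_subset[OF B n m])
  have HU: "l \<in> H_set B (U n)" "m \<in> H_set B (U n)"
    using z mU l mS unfolding H_set_def by blast+
  have B'm: "B' m = (d, t)"
    using lm by (simp add: B')
  have m'K: "m \<in> H_set B' (K n)"
  proof -
    obtain x where x: "x \<in> K n" "dist (ctr B m) x \<le> rad B m"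
      using m by (auto simp: H_set_def)
    then have "dist d x \<le> t"
      using dist_triangle3[of d x "ctr B m"] d(2) by (simp add: t)
    then show ?thesis
      using x pos by (auto simp: H_set_def S_set_def B'm t)
  qed
  then have m'U: "m \<in> H_set B' (U n)"
    using H_set_mono[OF K_sub[OF n]] by blast
  then have m'S: "m \<in> H_set B' UNIV"
    using H_set_mono by blast
  have SU: "l \<in> H_set B UNIV" "m \<in> H_set B UNIV"
    using l mS by simp_all
  show massU: "mass UNIV B' = mass UNIV B"
    using cost_merge(1)[OF _ SU lm B' m'S, of "\<lambda>x. x"] sm by (simp add: t)
  have massn: "mass (U n) B' = mass (U n) B"
    using cost_merge(1)[OF _ HU lm B' m'U, of "\<lambda>x. x"] sm by (simp add: t)
  have sm': "rad B' summable_on S_set B'"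
    using cost_merge(2)[OF _ SU lm B' m'S, of "\<lambda>x. x"] sm by simp
  have "conc t < conc (rad B l) + conc (rad B m)"
    unfolding t by (rule conc_strictly_subadditive[OF pos(3,4)])
  then show "cost conc UNIV B' < cost conc UNIV B"
    using cost_merge(1)[OF conc_summable[OF sm nn] SU lm B' m'S] by simp
  have nn': "0 \<le> rad B' i" for i
    using nn pos by (simp add: B' t)
  have m'_sub: "cball d t \<subseteq> U n"
    using touching_disc_subset[OF nn' sm' _ n m'K] massn admissibleD(6)[OF B n] by (simp add: B'm)
  show "admissible B'"
    unfolding admissible_def
  proof (intro conjI ballI allI impI)
    show "0 \<le> rad B' i" for i
      by (rule nn')
    show "B' 0 = A 0"
      using admissibleD(2)[OF B] pos by (simp add: B')
    show "ereal (cmod (ctr B' i)) \<le> mu A" if "i \<ge> 1" for i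
    proof -
      have "ereal (cmod d) \<le> mu A"
        using d(3) admissibleD(3)[OF B pos(1)] admissibleD(3)[OF B pos(2)]
          order_trans[of "ereal (cmod d)" "ereal (cmod (ctr B l))" "mu A"]
          order_trans[of "ereal (cmod d)" "ereal (cmod (ctr B m))" "mu A"] by auto
      then show ?thesis
        using admissibleD(3)[OF B that] mu_nonneg by (simp add: B' zero_ereal_def)
    qed
    show "rad B' summable_on S_set B'"
      by (rule sm')
    show "mass UNIV B' \<le> mass UNIV A"
      using massU admissibleD(5)[OF B] by simp
    show "mass (U p) B' \<le> mass (U p) A" if p: "p \<in> I" for p
    proof (cases "p = n")
      case True
      then show ?thesis
        using massn admissibleD(6)[OF B n] by simp
    next
      case False
      \<comment> \<open>The merged disk lies in \<open>U n\<close> and \<open>l\<close> has radius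
        zero, so only unaltered disks can meet \<open>U p\<close>.\<close>
      then have "m \<notin> H_set B' (U p)"
        using m'_sub U_disj[OF n p] by (auto simp: H_set_def B'm)
      then have *: "i \<noteq> l \<and> i \<noteq> m" if "i \<in> H_set B' (U p)" for i
        using that by (auto simp: H_set_def S_set_def B')
      have eq: "B' i = B i" if "i \<in> H_set B' (U p)" for i
        using *[OF that] by (simp add: B')
      have "i \<in> H_set B (U p)" if "i \<in> H_set B' (U p)" for i
        using that eq[OF that] by (simp add: H_set_def S_set_def)
      then have "mass (U p) B' \<le> mass (U p) B"
        by (intro cost_le_cost nn sm) (use eq in auto)
      then show ?thesis
        using admissibleD(6)[OF B p] by simp
    qed
    show "\<exists>i\<ge>1. B' i \<in> {A k}"
      if k: "k \<in> S_set A" and disj: "cball (ctr A k) (rad A k) \<inter> V_set I U = {}" for k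
    proof -
      obtain i where i: "i \<ge> 1" "B i = A k"
        using admissibleD(7)[OF B k disj] by blast
      \<comment> \<open>Both old disks contain \<open>z \<in> U n\<close>, so neither can be a disk
        disjoint from \<open>V_set I U\<close>, and the witness is unaltered.\<close>
      have "z \<in> U n" "U n \<subseteq> V_set I U"
        using z mU n by (auto simp: V_set_def)
      then have "i \<noteq> l" "i \<noteq> m"
        using disj z i(2) by auto
      then show ?thesis
        using i by (auto simp: B')
    qed
    show "\<exists>i\<ge>1. B' i \<in> cov p k"
      if p: "p \<in> I" and k: "k \<in> S_set A" and meets: "cball (ctr A k) (rad A k) \<inter> U p \<noteq> {}" for p k
    proof -
      obtain i where i: "i \<ge> 1" "B i \<in> cov p k"
        using admissibleD(8)[OF B p k meets] by blast
      show ?thesis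
      proof (cases "i = l \<or> i = m")
        case False
        then have "B' i = B i"
          by (simp add: B')
        then show ?thesis
          using i by metis
      next
        case True
        \<comment> \<open>The new disk contains the old witness and so covers disk \<open>k\<close>
          of \<open>A\<close>. That disk then lies in \<open>U n\<close>, and disjointness forces
          \<open>p = n\<close>, for which the new disk is a witness.\<close>
        have "dist (ctr A k) (ctr B i) + rad A k \<le> rad B i"
          by (rule cov_dist[OF i(2)])
        moreover have "dist (ctr B i) d + rad B i \<le> t"
          using True d by (auto simp: t)
        ultimately have le: "dist (ctr A k) d + rad A k \<le> t"
          using dist_triangle[of "ctr A k" d "ctr B i"] by simp
        then have "cball (ctr A k) (rad A k) \<subseteq> U n"
          using m'_sub by (meson cball_subset_cball_iff order_trans)
        then have "p = n"
          using meets index_of_U[OF n p] by blast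
        then have "B' m \<in> cov p k"
          using le m'K touch_iff[OF n] by (auto simp: cov_def B'm H_set_def)
        then show ?thesis
          using pos by blast
      qed
    qed
  qed
qed

section \<open>The optimum is classical and agrees with \<open>A\<close> outside the
  \<open>U n\<close>\<close>

lemma cball_A_subset:
  assumes k: "k \<in> S_set A"
  shows "cball (ctr A k) (rad A k) \<subseteq> ball (ctr A 0) (rad A 0)"
proof (rule ccontr)
  assume "\<not> ?thesis"
  then obtain z where z: "z \<in> cball (ctr A k) (rad A k)" "z \<notin> ball (ctr A 0) (rad A 0)"
    by blast
  \<comment> \<open>Error points lie in some \<open>K n\<close>, hence inside the open outer disk,
    which \<open>z\<close> avoids.\<close>
  then have "z \<in> error_set A"
    using k unfolding error_set_def by blast
  then obtain n where "n \<in> I" "z \<in> K n"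
    using err by (auto simp: F_set_def)
  then show False
    using z K_sub U_sub by blast
qed

lemma exists_classical_optimum:
  "\<exists>B \<in> L_star A I K U. X_set B - V_set I U = X_set A - V_set I U \<and> classical B"
proof -
  obtain B where B: "B \<in> candidates"
    and opt: "\<And>B'. admissible B' \<Longrightarrow> mass UNIV B \<le> mass UNIV B'"
    and opt2: "\<And>B'. admissible B' \<Longrightarrow> (\<And>n. n \<ge> 1 \<Longrightarrow> cmod (ctr B' n) \<le> bound) \<Longrightarrow>
      mass UNIV B' = mass UNIV B \<Longrightarrow> cost conc UNIV B \<le> cost conc UNIV B'"
    by (rule optimal_candidate) (rule that; blast)
  have adm: "admissible B" and anti: "antimono_on {1..} (rad B)"
    and bd: "\<And>n. n \<ge> 1 \<Longrightarrow> cmod (ctr B n) \<le> bound"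
    using B by (auto simp: candidates_def)
  note nn = admissibleD(1)[OF adm] and sm = admissibleD(4)[OF adm]
  have B0: "B 0 = A 0"
    by (rule admissibleD(2)[OF adm])
  have not_clear: "\<not> admissible (clear {l} B)" if "l \<in> S_set B" for l
    using opt mass_clear_less[OF nn sm that] by fastforce

  have kind: "(\<exists>k\<in>S_set A. B l = A k) \<or> (\<exists>n\<in>I. l \<in> H_set B (K n))" if l: "l \<in> S_set B" for l
  proof (rule ccontr)
    assume *: "\<not> ?thesis"
    \<comment> \<open>Both alternatives in \<open>cov n k\<close> are excluded, so the disk
      witnesses nothing and its deletion harms no clause.\<close>
    have "B l \<notin> cov n k" if "n \<in> I" "k \<in> S_set A" for n k
      using * l that touch_iff[OF that(1), of "ctr B l" "rad B l"] by (auto simp: cov_def H_set_def)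
    then have "admissible (clear {l} B)"
      by (intro admissible_clear adm) (use * S_setD[OF l] in auto)
    then show False
      using not_clear[OF l] by blast
  qed

  have no_merge: False
    if n: "n \<in> I" and l: "l \<in> S_set B" and m: "m \<in> H_set B (K n)" and lm: "l \<noteq> m"
      and z: "z \<in> cball (ctr B l) (rad B l)" "z \<in> cball (ctr B m) (rad B m)" for n l m z
  proof -
    have pos: "l \<ge> 1" "m \<ge> 1" "rad B l > 0" "rad B m > 0"
      using S_setD[OF l] S_setD[of m B] m H_set_subset[of B "K n"] by auto
    have "dist (ctr B l) (ctr B m) \<le> rad B l + rad B m"
      using z dist_triangle2[of "ctr B l" "ctr B m" z] by simp
    then obtain d where d: "dist (ctr B l) d \<le> rad B m" "dist (ctr B m) d \<le> rad B l"
      "cmod d \<le> cmod (ctr B l) \<or> cmod d \<le> cmod (ctr B m)"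
      by (rule enclosing_disc[OF pos(3,4)]) (rule that)
    define B' where "B' = B(m := (d, rad B l + rad B m), l := (0, 0))"
    \<comment> \<open>The tie-break was minimised only over cheeses with bounded centres, so the
      merged one must be among them.\<close>
    have "cmod d \<le> bound"
      using d(3) bd[OF pos(1)] bd[OF pos(2)] by auto
    then have "cmod (ctr B' i) \<le> bound" if "i \<ge> 1" for i
      using bd[OF that] bound_nonneg by (simp add: B'_def)
    then show False
      using opt2[of B'] admissible_merge[OF adm n l m lm z refl d B'_def] by simp
  qed

  have disjoint: "cball (ctr B l) (rad B l) \<inter> cball (ctr B m) (rad B m) = {}"
    if l: "l \<in> S_set B" and m: "m \<in> S_set B" and lm: "l \<noteq> m" for l m
  proof (rule ccontr)
    assume "\<not> ?thesis"
    then obtain z where z: "z \<in> cball (ctr B l) (rad B l)" "z \<in> cball (ctr B m) (rad B m)"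
      by blast
    have "l \<notin> H_set B (K n)" "m \<notin> H_set B (K n)" if "n \<in> I" for n
      using no_merge[OF that l _ lm z] no_merge[OF that m _ lm[symmetric] z(2,1)] by blast+
    then obtain k j where kj: "k \<in> S_set A" "B l = A k" "j \<in> S_set A" "B m = A j"
      using kind[OF l] kind[OF m] by blast
    show False
    proof (cases "k = j")
      case True
      then have eq: "B m = B l"
        using kj by simp
      \<comment> \<open>Of two equal disks the remaining one takes over as witness.\<close>
      have "admissible (clear {l} B)"
        by (intro admissible_clear adm) (use S_setD[OF l] S_setD[OF m] eq lm in force)+
      then show False
        using not_clear[OF l] by blast
    next
      case False
      then have "z \<in> error_set A"
        using z kj unfolding error_set_def by auto
      then obtain n where "n \<in> I" "z \<in> K n"
        using err by (auto simp: F_set_def)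
      then have "l \<in> H_set B (K n)"
        using z l by (auto simp: H_set_def)
      then show False
        using no_merge[OF \<open>n \<in> I\<close> m _ lm[symmetric] z(2,1)] by blast
    qed
  qed

  have inside: "cball (ctr B l) (rad B l) \<subseteq> ball (ctr A 0) (rad A 0)" if l: "l \<in> S_set B" for l
    using kind[OF l]
  proof (elim disjE bexE)
    fix k assume "k \<in> S_set A" "B l = A k"
    then show ?thesis
      using cball_A_subset by simp
  next
    fix n assume "n \<in> I" "l \<in> H_set B (K n)"
    then show ?thesis
      using admissible_touching_disc_subset[OF adm] U_sub by blast
  qed

  have "classical B"
    unfolding classical_def
    using admissible_imp_L_set(2)[OF adm anti] B0 rad_A0_pos inside disjoint by simp

  moreover have "B \<in> L_star A I K U"
    unfolding L_star_def
  proof (intro CollectI conjI ballI)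
    show "B \<in> L_set A I K U"
      by (rule admissible_imp_L_set(1)[OF adm anti])
    fix B' assume "B' \<in> L_set A I K U"
    note B' = L_set_imp_admissible[OF this]
    show "delta1 B' \<le> delta1 B"
      using opt[OF B'(1)] admissibleD(2)[OF B'(1)] B0
      by (simp add: delta1_def B'(3) admissible_imp_L_set(2)[OF adm anti])
  qed

  moreover have "X_set B - V_set I U = X_set A - V_set I U"
  proof -
    \<comment> \<open>Disks of \<open>B\<close> touching some \<open>K n\<close> lie in
      \<open>V_set I U\<close>, so outside it only disks of \<open>A\<close> count; conversely each
      disk of \<open>A\<close> is contained in one of \<open>B\<close>.\<close>
    have "(\<exists>l\<ge>1. z \<in> ball (ctr B l) (rad B l)) \<longleftrightarrow> (\<exists>k\<ge>1. z \<in> ball (ctr A k) (rad A k))"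
      if z: "z \<notin> V_set I U" for z
    proof
      assume "\<exists>l\<ge>1. z \<in> ball (ctr B l) (rad B l)"
      then obtain l where l: "l \<ge> 1" "z \<in> ball (ctr B l) (rad B l)"
        by blast
      then have lS: "l \<in> S_set B"
        using zero_le_dist[of "ctr B l" z] by (auto simp: S_set_def simp del: zero_le_dist)
      have "l \<notin> H_set B (K n)" if "n \<in> I" for n
        using admissible_touching_disc_subset[OF adm that, of l] l(2) z that
          ball_subset_cball[of "ctr B l" "rad B l"] unfolding V_set_def by blast
      then obtain k where "k \<in> S_set A" "B l = A k"
        using kind[OF lS] by blast
      then show "\<exists>k\<ge>1. z \<in> ball (ctr A k) (rad A k)"
        using l(2) S_setD by metis
    next
      assume "\<exists>k\<ge>1. z \<in> ball (ctr A k) (rad A k)"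
      then obtain k where k: "k \<ge> 1" "z \<in> ball (ctr A k) (rad A k)"
        by blast
      then have kS: "k \<in> S_set A"
        using zero_le_dist[of "ctr A k" z] by (auto simp: S_set_def simp del: zero_le_dist)
      show "\<exists>l\<ge>1. z \<in> ball (ctr B l) (rad B l)"
      proof (cases "cball (ctr A k) (rad A k) \<inter> V_set I U = {}")
        case True
        then obtain l where "l \<ge> 1" "B l = A k"
          using admissibleD(7)[OF adm kS] by blast
        then show ?thesis
          using k by metis
      next
        case False
        then obtain n where n: "n \<in> I" "cball (ctr A k) (rad A k) \<inter> U n \<noteq> {}"
          by (auto simp: V_set_def)
        obtain l where l: "l \<ge> 1" "B l \<in> cov n k"
          using admissibleD(8)[OF adm n(1) kS n(2)] by blast
        \<comment> \<open>The inequality in \<open>cov_dist\<close> holds with equality for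
          \<open>A k\<close> itself, so both kinds of witness are handled together.\<close>
        have "ball (ctr A k) (rad A k) \<subseteq> ball (ctr B l) (rad B l)"
          using cov_dist[OF l(2)] by (simp add: ball_subset_ball_iff)
        then show ?thesis
          using k l by blast
      qed
    qed
    then show ?thesis
      unfolding X_set_def B0 by fastforce
  qed

  ultimately show ?thesis
    by blast
qed

end

theorem theorem5p7:
  fixes A :: cheese
    and I :: "nat set"
    and K U :: "nat \<Rightarrow> complex set"
    and M :: "nat \<Rightarrow> real"
  assumes "A \<in> N_set"
    and "redundancy_free A"
    and "I \<noteq> {}" and "I \<subseteq> {1..}"
    and "\<And>n. n \<in> I \<Longrightarrow> compact_plane_set (K n)"
    and "\<And>n. n \<in> I \<Longrightarrow> M n > 0"
    and "\<And>n. n \<in> I \<Longrightarrow> U n = nbhd (K n) (M n)"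
    and "\<And>k. k \<in> I \<Longrightarrow> U k \<subseteq> ball (ctr A 0) (rad A 0)"
    and "\<And>k. k \<in> I \<Longrightarrow> rho_on (U k) A < ereal (M k / 2)"
    and "\<And>k l. k \<in> I \<Longrightarrow> l \<in> I \<Longrightarrow> k \<noteq> l \<Longrightarrow> U k \<inter> U l = {}"
    and "error_set A \<subseteq> F_set I K"
  shows "\<exists>B \<in> L_star A I K U.
           X_set B - V_set I U = X_set A - V_set I U \<and> classical B"
proof -
  interpret controlled_cheese A I K U M
    by unfold_locales (fact assms)+
  show ?thesis
    by (rule exists_classical_optimum)
qed

end
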